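(* Let $A\subset\mathbb{R}^d$ be a bounded set. Let $r=(M,t)\in SO(d)\times\mathbb{R}^d$ be a rigid motion, i.e. $r(x)=Mx+t$, and let $w=\max_{a\in\partial A}|a-Ma|$. If $\partial A$ is $(\mathcal{H}^{d-1},d-1)$-rectifiable, then $$\mathcal{H}^d\bigl(A\bigtriangleup r(A)\bigr)\le(|t|+w)\,\mathcal{H}^{d-1}(\partial A).$$
   Context: Notation: $|\cdot|$ is the Euclidean norm; $SO(d)\subset\mathbb{R}^{d\times d}$ is the group of rotation matrices; $A \bigtriangleup B = (A\setminus B)\cup(B\setminus A)$; the boundary $\partial A$ is $\operatorname{cl}(A)\setminus\operatorname{int}(A)$. Hausdorff measure: for an integer $0\le k\le d$, let $\omega_k$ denote the volume of the Euclidean unit ball in $\mathbb{R}^k$ (with $\omega_0=1$). For an arbitrary set $A\subset\mathbb{R}^d$ (no measurability required) and $\delta>0$ put $$\mathcal{H}^k_\delta(A)=\omega_k 2^{-k}\inf\Bigl\{\sum_{j=0}^\infty(\operatorname{diam}B_j)^k : B_j\subset\mathbb{R}^d,\ \operatorname{diam}B_j\le\delta \text{ for all } j,\ A\subset\bigcup_{j=0}^\infty B_j\Bigr\},$$ and $\mathcal{H}^k(A)=\lim_{\delta\to 0^+}\mathcal{H}^k_\delta(A)\in[0,\infty]$ (for $k=0$, $(\operatorname{diam} B)^0$ is $1$ for nonempty $B$ and $0$ for $B=\emptyset$, so $\mathcal{H}^0$ is counting measure). With this normalization $\mathcal{H}^d$ agrees with Lebesgue measure on Lebesgue measurable subsets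 of $\mathbb{R}^d$. Rectifiability: a subset $E$ of a metric space is $k$-rectifiable if there is a Lipschitz continuous function mapping some bounded subset of $\mathbb{R}^k$ onto $E$. A union of countably many $k$-rectifiable sets is called countably $k$-rectifiable. $E$ is countably $(\mu,k)$-rectifiable if $\mu$ is a measure defined on $E$ and there is a countably $k$-rectifiable set containing $\mu$-almost all of $E$. If additionally $\mu(E)<\infty$, then $E$ is called $(\mu,k)$-rectifiable. *)

theory Defs
  imports "HOL-Analysis.Analysis"
begin

text \<open>
  On unbounded sets the library's \<open>diameter\<close> is a junk real, so boundedness (finite diameter) is
  demanded separately. The empty set is singled out because \<open>diameter {} ^ 0 = 1\<close>, whereas the
  convention for \<open>k = 0\<close> is that the empty set contributes nothing.
\<close>

definition hausdorff_content :: "nat \<Rightarrow> real \<Rightarrow> 'a::metric_space set \<Rightarrow> ennreal" where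
  "hausdorff_content k \<delta> A =
     ennreal (unit_ball_vol (real k) / 2 ^ k) *
     (INF B \<in> {B :: nat \<Rightarrow> 'a set. (\<forall>j. bounded (B j) \<and> diameter (B j) \<le> \<delta>) \<and> A \<subseteq> (\<Union>j. B j)}.
        \<Sum>j. if B j = {} then 0 else ennreal (diameter (B j) ^ k))"

definition hausdorff_measure :: "nat \<Rightarrow> 'a::metric_space set \<Rightarrow> ennreal" where
  "hausdorff_measure k A = Lim (at_right 0) (\<lambda>\<delta>. hausdorff_content k \<delta> A)"

lemma hausdorff_content_antimono:
  assumes "\<delta> \<le> \<epsilon>"
  shows "hausdorff_content k \<epsilon> A \<le> hausdorff_content k \<delta> A"
  unfolding hausdorff_content_def
  by (intro mult_left_mono INF_superset_mono) (use assms in \<open>auto intro: order_trans\<close>)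

text \<open>The limit defining the Hausdorff measure always exists in \<open>[0, \<infinity>]\<close>.\<close>

lemma hausdorff_content_tendsto_SUP:
  "((\<lambda>\<delta>. hausdorff_content k \<delta> A) \<longlongrightarrow> (SUP \<delta>\<in>{0<..}. hausdorff_content k \<delta> A)) (at_right 0)"
proof (rule order_tendstoI)
  fix a assume "a < (SUP \<delta>\<in>{0<..}. hausdorff_content k \<delta> A)"
  then obtain \<delta> where \<delta>: "0 < \<delta>" "a < hausdorff_content k \<delta> A"
    by (auto simp: less_SUP_iff)
  show "\<forall>\<^sub>F x in at_right 0. a < hausdorff_content k x A"
    using eventually_at_right_less[of 0] eventually_at_right_real[OF \<delta>(1)]
    by eventually_elim
      (auto intro!: less_le_trans[OF \<delta>(2)] hausdorff_content_antimono)
next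
  fix a assume *: "(SUP \<delta>\<in>{0<..}. hausdorff_content k \<delta> A) < a"
  show "\<forall>\<^sub>F x in at_right 0. hausdorff_content k x A < a"
    using eventually_at_right_less[of 0]
  proof eventually_elim
    case (elim x)
    then have "hausdorff_content k x A \<le> (SUP \<delta>\<in>{0<..}. hausdorff_content k \<delta> A)"
      by (intro SUP_upper) simp
    then show ?case
      using * by (rule le_less_trans)
  qed
qed

lemma hausdorff_measure_eq_SUP:
  "hausdorff_measure k A = (SUP \<delta>\<in>{0<..}. hausdorff_content k \<delta> A)"
  unfolding hausdorff_measure_def
  by (intro tendsto_Lim hausdorff_content_tendsto_SUP) simp

text \<open>
  The space \<open>\<real>\<^sup>k\<close> for a natural number \<open>k\<close> that is a term rather than a type. Its points are those
  of the library's \<open>Euclidean_space k\<close>. The metric has to be given explicitly, because the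
  \<open>metric_space\<close> instance of \<^typ>\<open>nat \<Rightarrow> real\<close> is bounded and not Euclidean.
\<close>

definition euclid_dist :: "nat \<Rightarrow> (nat \<Rightarrow> real) \<Rightarrow> (nat \<Rightarrow> real) \<Rightarrow> real" where
  "euclid_dist k x y = L2_set (\<lambda>i. x i - y i) {..<k}"

definition euclid_metric :: "nat \<Rightarrow> (nat \<Rightarrow> real) metric" where
  "euclid_metric k = metric (topspace (Euclidean_space k), euclid_dist k)"

lemma Metric_space_euclid: "Metric_space (topspace (Euclidean_space k)) (euclid_dist k)"
proof
  fix x y z :: "nat \<Rightarrow> real"
  show "0 \<le> euclid_dist k x y"
    by (simp add: euclid_dist_def)
  show "euclid_dist k x y = euclid_dist k y x"
    by (simp add: euclid_dist_def L2_set_def power2_commute)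
  show "euclid_dist k x y = 0 \<longleftrightarrow> x = y"
    if "x \<in> topspace (Euclidean_space k)" "y \<in> topspace (Euclidean_space k)"
  proof -
    have "x i = y i" if "\<forall>j<k. x j = y j" for i
      using that \<open>x \<in> _\<close> \<open>y \<in> _\<close> by (cases "i < k") (auto simp: topspace_Euclidean_space)
    then show ?thesis
      by (auto simp: euclid_dist_def L2_set_eq_0_iff)
  qed
  show "euclid_dist k x z \<le> euclid_dist k x y + euclid_dist k y z"
    using L2_set_triangle_ineq[of "\<lambda>i. x i - y i" "\<lambda>i. y i - z i" "{..<k}"]
    by (simp add: euclid_dist_def)
qed

lemma mspace_euclid_metric [simp]: "mspace (euclid_metric k) = topspace (Euclidean_space k)"
  and mdist_euclid_metric [simp]: "mdist (euclid_metric k) = euclid_dist k"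
  by (simp_all add: euclid_metric_def Metric_space_euclid
      Metric_space.mspace_metric Metric_space.mdist_metric)

definition k_rectifiable :: "nat \<Rightarrow> 'a::metric_space set \<Rightarrow> bool" where
  "k_rectifiable k E \<longleftrightarrow>
     (\<exists>S f. Metric_space.mbounded (mspace (euclid_metric k)) (mdist (euclid_metric k)) S \<and>
        Lipschitz_continuous_map (submetric (euclid_metric k) S) euclidean_metric f \<and> f ` S = E)"

lemma k_rectifiable_iff:
  fixes E :: "'a::metric_space set"
  shows "k_rectifiable k E \<longleftrightarrow>
     (\<exists>S f L C. S \<subseteq> {x. \<forall>i\<ge>k. x i = 0} \<and>
        (\<forall>x\<in>S. \<forall>y\<in>S. euclid_dist k x y \<le> C) \<and>
        (\<forall>x\<in>S. \<forall>y\<in>S. dist (f x) (f y) \<le> L * euclid_dist k x y) \<and> f ` S = E)"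
proof -
  have "Metric_space.mbounded (mspace (euclid_metric k)) (mdist (euclid_metric k)) S \<and>
        Lipschitz_continuous_map (submetric (euclid_metric k) S) euclidean_metric f \<and> f ` S = E
    \<longleftrightarrow> (\<exists>L C. S \<subseteq> {x. \<forall>i\<ge>k. x i = 0} \<and>
        (\<forall>x\<in>S. \<forall>y\<in>S. euclid_dist k x y \<le> C) \<and>
        (\<forall>x\<in>S. \<forall>y\<in>S. dist (f x) (f y) \<le> L * euclid_dist k x y) \<and> f ` S = E)"
    (is "?l \<longleftrightarrow> ?r") for S and f :: "_ \<Rightarrow> 'a"
  proof -
    have mb: "Metric_space.mbounded (mspace (euclid_metric k)) (mdist (euclid_metric k)) S \<longleftrightarrow>
        S \<subseteq> topspace (Euclidean_space k) \<and> (\<exists>C. \<forall>x\<in>S. \<forall>y\<in>S. euclid_dist k x y \<le> C)"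
      by (simp add: Metric_space.mbounded_alt[OF Metric_space_euclid])
    show ?thesis
    proof (cases "S \<subseteq> topspace (Euclidean_space k)")
      case True
      then have "S \<inter> topspace (Euclidean_space k) = S"
        by blast
      with True show ?thesis
        unfolding mb by (simp add: Lipschitz_continuous_map_def topspace_Euclidean_space)
    next
      case False
      then show ?thesis
        unfolding mb by (simp add: topspace_Euclidean_space)
    qed
  qed
  then show ?thesis
    unfolding k_rectifiable_def by presburger
qed

definition countably_k_rectifiable :: "nat \<Rightarrow> 'a::metric_space set \<Rightarrow> bool" where
  "countably_k_rectifiable k E \<longleftrightarrow>
     (\<exists>\<C>. countable \<C> \<and> (\<forall>F\<in>\<C>. k_rectifiable k F) \<and> E = \<Union>\<C>)"

text \<open>
  Here \<open>\<mu>\<close> is a measure in the sense of geometric measure theory, i.e. an outer measure defined on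
  arbitrary sets, such as \<open>hausdorff_measure k\<close>.
\<close>

definition countably_measure_rectifiable ::
    "('a::metric_space set \<Rightarrow> ennreal) \<Rightarrow> nat \<Rightarrow> 'a set \<Rightarrow> bool" where
  "countably_measure_rectifiable \<mu> k E \<longleftrightarrow>
     (\<exists>F. countably_k_rectifiable k F \<and> \<mu> (E - F) = 0)"

definition measure_rectifiable ::
    "('a::metric_space set \<Rightarrow> ennreal) \<Rightarrow> nat \<Rightarrow> 'a set \<Rightarrow> bool" where
  "measure_rectifiable \<mu> k E \<longleftrightarrow> countably_measure_rectifiable \<mu> k E \<and> \<mu> E < \<infinity>"

text \<open>For nonempty bounded \<open>A\<close> the supremum of the displacement over the boundary is a maximum.\<close>

lemma frontier_displacement_SUP_attained:
  fixes A :: "(real ^ 'n) set" and M :: "real ^ 'n ^ 'n"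
  assumes "bounded A" "A \<noteq> {}"
  shows "\<exists>b\<in>frontier A. (SUP a\<in>frontier A. norm (a - M *v a)) = norm (b - M *v b) \<and>
           (\<forall>a\<in>frontier A. norm (a - M *v a) \<le> norm (b - M *v b))"
proof -
  have "compact (frontier A)" "frontier A \<noteq> {}"
    using assms by (auto simp: compact_frontier_bounded frontier_eq_empty )
  moreover have "continuous_on (frontier A) (\<lambda>a. norm (a - M *v a))"
    by (intro continuous_intros matrix_vector_mult_linear_continuous_on)
  ultimately obtain b where b: "b \<in> frontier A"
      "\<forall>a\<in>frontier A. norm (a - M *v a) \<le> norm (b - M *v b)"
    using continuous_attains_sup[of "frontier A" "\<lambda>a. norm (a - M *v a)"] by blast
  then have "(SUP a\<in>frontier A. norm (a - M *v a)) = norm (b - M *v b)"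
    by (intro cSup_eq_maximum) auto
  with b show ?thesis by blast
qed

end

theory Submission
  imports Defs
begin

text \<open>
  Move every point in a straight line, \<open>slide r s x = x + s (r x - x)\<close>, from \<open>x\<close> at time \<open>s = 0\<close> to
  \<open>r x\<close> at time \<open>s = 1\<close>. Suppose that no boundary point of \<open>A\<close> ever passes through \<open>p\<close>. As long as the
  affine maps \<open>slide r s\<close> are invertible, the preimage of \<open>p\<close> moves continuously and cannot
  leave or enter \<open>A\<close>, so \<open>p \<in> A\<close> iff \<open>p \<in> r ` A\<close>. Invertibility fails at most at time \<open>1/2\<close>, when \<open>-1\<close>
  is an eigenvalue of the rotation; then the points in the range of \<open>slide r (1/2)\<close> have to be excepted,
  and they form a null set. Hence \<open>A \<bigtriangleup> r(A)\<close> is covered, up to a null set, by the tracks of the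
  boundary points (\<open>sym_diff_subset_sweep\<close>).

  It remains to bound the volume of these tracks. Let \<open>W\<close> bound the lengths of the tracks,
  let \<open>B\<close> be a piece of the boundary of small diameter \<open>\<delta>\<close>, and cut its sweep by hyperplanes orthogonal
  to the displacement of one of its points. Two points in the same cut belong to almost the same time,
  and \<open>slide r s\<close> does not increase distances between points at equal times, because its linear part is a convex
  combination of two isometries. So the cut has diameter at most \<open>(1 + o(1)) \<delta>\<close>, and by the isodiametric
  inequality its area is at most \<open>(1 + o(1)) \<omega> (\<delta> / 2)^(d-1)\<close>, where \<open>\<omega>\<close> is the volume of the unit ball of
  dimension \<open>d - 1\<close>. The cuts fill a length of at most \<open>W + 2 \<delta>\<close>; thus the sweep of \<open>B\<close> has volume at most
  \<open>(W + \<epsilon>) \<omega> (\<delta> / 2)^(d-1)\<close> (\<open>emeasure_sweep_le\<close>). Where the displacement is too short for the cuts to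
  determine the time, the area of a cut is still at most \<open>3^(d-1)\<close> times the area above, which the short
  length of the track outweighs (\<open>sweep_volume_limit\<close>). The constant is exactly the one in the
  definition of the Hausdorff measure. Summing over an almost optimal cover of the boundary and
  letting \<open>\<epsilon>\<close> tend to \<open>0\<close>, which is harmless because the boundary has finite measure, gives the bound for
  the Lebesgue outer measure.

  The left-hand side is a Hausdorff measure of a set that may fail to be measurable. The
  inequality \<open>hausdorff_measure_le_lebesgue\<close>, a consequence of the Vitali covering theorem, makes it possible to
  estimate it by the Lebesgue measure of a measurable superset.
\<close>


section \<open>The isodiametric inequality\<close>

text \<open>
  Applied to two parallel lines meeting a set of bounded diameter: the lengths of the two sections are
  controlled by the distances between points of different sections only. Indeed
  \<open>Sup A - Inf B\<close> and \<open>Sup B - Inf A\<close> are at most \<open>L\<close>, and they add up to the lengths of the two hulls.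
\<close>

lemma emeasure_add_le_of_mutual_dist:
  fixes A B :: "real set"
  assumes "A \<noteq> {}" "B \<noteq> {}" and dist: "\<And>s t. s \<in> A \<Longrightarrow> t \<in> B \<Longrightarrow> \<bar>s - t\<bar> \<le> L"
  shows "emeasure lborel A + emeasure lborel B \<le> ennreal (2 * L)"
proof -
  obtain a b where ab: "a \<in> A" "b \<in> B" using assms by blast
  have bA: "bdd_below A" "bdd_above A"
    using dist[OF _ ab(2)] by (auto intro!: bdd_belowI[of _ "b - L"] bdd_aboveI[of _ "b + L"] simp: abs_le_iff; force)+
  have bB: "bdd_below B" "bdd_above B"
    using dist[OF ab(1)] by (auto intro!: bdd_belowI[of _ "a - L"] bdd_aboveI[of _ "a + L"] simp: abs_le_iff; force)+
  have 1: "Sup A \<le> Inf B + L"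
  proof (rule cSup_least[OF assms(1)])
    fix s assume "s \<in> A"
    have "s - L \<le> Inf B"
      using assms(2) by (rule cInf_greatest) (use dist[OF \<open>s \<in> A\<close>] in \<open>force simp: abs_le_iff\<close>)
    then show "s \<le> Inf B + L" by simp
  qed
  have 2: "Sup B \<le> Inf A + L"
  proof (rule cSup_least[OF assms(2)])
    fix t assume "t \<in> B"
    have "t - L \<le> Inf A"
      using assms(1) by (rule cInf_greatest) (use dist[OF _ \<open>t \<in> B\<close>] in \<open>force simp: abs_le_iff\<close>)
    then show "t \<le> Inf A + L" by simp
  qed
  have le: "Inf A \<le> Sup A" "Inf B \<le> Sup B"
    using assms bA bB by (auto intro: cInf_le_cSup)
  have "emeasure lborel A \<le> emeasure lborel {Inf A..Sup A}"
       "emeasure lborel B \<le> emeasure lborel {Inf B..Sup B}"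
    using bA bB by (auto intro!: emeasure_mono cInf_lower cSup_upper)
  then have "emeasure lborel A + emeasure lborel B \<le> ennreal (Sup A - Inf A) + ennreal (Sup B - Inf B)"
    using le by (intro add_mono) auto
  also have "\<dots> = ennreal ((Sup A - Inf A) + (Sup B - Inf B))"
    using le by (intro ennreal_plus[symmetric]) auto
  also have "\<dots> \<le> ennreal (2 * L)"
    using 1 2 by (intro ennreal_leI) linarith
  finally show ?thesis .
qed

lemma emeasure_centred_interval: "emeasure lborel {t::real. ennreal (2 * \<bar>t\<bar>) < m} = m"
proof (cases m)
  case (real c)
  have "{t::real. ennreal (2 * \<bar>t\<bar>) < m} = {- c / 2 <..< c / 2}"
    using real by (auto simp: ennreal_less_iff abs_less_iff)
  then show ?thesis using real by simp
next
  case top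
  then have "{t::real. ennreal (2 * \<bar>t\<bar>) < m} = UNIV" by auto
  then show ?thesis using top by simp
qed

text \<open>
  Replacing every section in the \<open>i\<close>-th direction by the centred open interval of the same length
  keeps the volume by Fubini. It keeps the diameter bound because, by
  \<open>emeasure_add_le_of_mutual_dist\<close>, already the original sections contain points that are at least
  as far apart as any two points of the new ones. Taking open intervals makes the new
  set measurable without a measurability condition on the projection: sections of length \<open>0\<close>
  become empty. The last clause allows symmetrizations in different directions to be combined.
\<close>

lemma steiner_symmetrization:
  fixes K :: "('i \<Rightarrow> real) set"
  assumes fin: "finite I" and i: "i \<in> I" and K: "K \<in> sets (Pi\<^sub>M I (\<lambda>_. lborel))"
    and diam: "\<And>x y. x \<in> K \<Longrightarrow> y \<in> K \<Longrightarrow> (\<Sum>j\<in>I. (x j - y j)\<^sup>2) \<le> D\<^sup>2"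
  obtains K' where "K' \<in> sets (Pi\<^sub>M I (\<lambda>_. lborel))"
    "emeasure (Pi\<^sub>M I (\<lambda>_. lborel)) K' = emeasure (Pi\<^sub>M I (\<lambda>_. lborel)) K"
    "\<And>x y. x \<in> K' \<Longrightarrow> y \<in> K' \<Longrightarrow> (\<Sum>j\<in>I. (x j - y j)\<^sup>2) \<le> D\<^sup>2"
    "\<And>x. x \<in> K' \<Longrightarrow> x(i := - x i) \<in> K'"
    "\<And>j x. \<lbrakk>j \<in> I; \<And>x. x \<in> K \<Longrightarrow> x(j := - x j) \<in> K; x \<in> K'\<rbrakk> \<Longrightarrow> x(j := - x j) \<in> K'"
proof -
  let ?P = "Pi\<^sub>M I (\<lambda>_. lborel :: real measure)"
  interpret product_sigma_finite "\<lambda>_. lborel :: real measure" ..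
  define m where "m x = emeasure lborel {t. x(i := t) \<in> K}" for x
  define K' where "K' = {x \<in> space ?P. ennreal (2 * \<bar>x i\<bar>) < m x}"
  have upd [measurable]: "(\<lambda>(x, t). x(i := t)) \<in> measurable (?P \<Otimes>\<^sub>M lborel) ?P"
    using measurable_add_dim[of i I "\<lambda>_. lborel :: real measure"] i by (simp add: insert_absorb)
  have K_upd: "{t. x(i := t) \<in> K} \<in> sets lborel" if "x \<in> space ?P" for x
  proof -
    have "(\<lambda>t. x(i := t)) \<in> measurable lborel ?P"
      using measurable_compose[OF measurable_Pair1'[OF that] upd] by simp
    from measurable_sets[OF this K] show ?thesis by (simp add: vimage_def)
  qed
  have m_meas [measurable]: "m \<in> borel_measurable ?P"
  proof -
    have "{z \<in> space (?P \<Otimes>\<^sub>M lborel). (\<lambda>(x, t). x(i := t)) z \<in> K} \<in> sets (?P \<Otimes>\<^sub>M lborel)"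
      using K by measurable
    from lborel.measurable_emeasure_Pair[OF this]
    show ?thesis
      by (rule measurable_cong[THEN iffD1, rotated]) (auto simp: m_def space_pair_measure vimage_def)
  qed
  have K'_sets: "K' \<in> sets ?P"
    unfolding K'_def using i by measurable
  have m_upd: "m (x(i := t)) = m x" for x t
    by (simp add: m_def)
  show ?thesis
  proof (rule that[OF K'_sets])
    let ?J = "I - {i}"
    have ins: "insert i ?J = I" using i by auto
    have spc: "y(i := t) \<in> space ?P" if "y \<in> space (Pi\<^sub>M ?J (\<lambda>_. lborel :: real measure))" for y t
      using that i by (auto simp: space_PiM PiE_iff extensional_def)
    have sec: "emeasure ?P X = (\<integral>\<^sup>+ y. emeasure lborel {t. y(i := t) \<in> X} \<partial>Pi\<^sub>M ?J (\<lambda>_. lborel))"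
      if X: "X \<in> sets ?P" "\<And>y. y \<in> space (Pi\<^sub>M ?J (\<lambda>_. lborel :: real measure)) \<Longrightarrow> {t. y(i := t) \<in> X} \<in> sets lborel" for X
    proof -
      have "emeasure ?P X = (\<integral>\<^sup>+ x. indicator X x \<partial>?P)" using X by simp
      also have "\<dots> = (\<integral>\<^sup>+ y. (\<integral>\<^sup>+ t. indicator X (y(i := t)) \<partial>lborel) \<partial>Pi\<^sub>M ?J (\<lambda>_. lborel))"
        using product_nn_integral_insert[of ?J i "indicator X"] fin X unfolding ins by simp
      also have "\<dots> = (\<integral>\<^sup>+ y. emeasure lborel {t. y(i := t) \<in> X} \<partial>Pi\<^sub>M ?J (\<lambda>_. lborel))"
      proof (rule nn_integral_cong)
        fix y assume "y \<in> space (Pi\<^sub>M ?J (\<lambda>_. lborel :: real measure))"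
        then show "(\<integral>\<^sup>+ t. indicator X (y(i := t)) \<partial>lborel) = emeasure lborel {t. y(i := t) \<in> X}"
          by (subst nn_integral_indicator[symmetric, OF X(2)]) (auto intro!: nn_integral_cong simp: indicator_def)
      qed
      finally show ?thesis .
    qed
    show "emeasure ?P K' = emeasure ?P K"
    proof -
      have K'sec: "{t. y(i := t) \<in> K'} = {t. ennreal (2 * \<bar>t\<bar>) < m y}"
        if "y \<in> space (Pi\<^sub>M ?J (\<lambda>_. lborel :: real measure))" for y
        using spc[OF that] by (simp add: K'_def m_upd)
      have "emeasure ?P K' = (\<integral>\<^sup>+ y. emeasure lborel {t. y(i := t) \<in> K'} \<partial>Pi\<^sub>M ?J (\<lambda>_. lborel))"
        by (rule sec[OF K'_sets]) (simp add: K'sec)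
      also have "\<dots> = (\<integral>\<^sup>+ y. m y \<partial>Pi\<^sub>M ?J (\<lambda>_. lborel))"
        by (rule nn_integral_cong) (simp add: K'sec emeasure_centred_interval)
      also have "\<dots> = emeasure ?P K"
        unfolding m_def
      proof (rule sec[OF K, symmetric])
        fix y assume "y \<in> space (Pi\<^sub>M ?J (\<lambda>_. lborel :: real measure))"
        from K_upd[OF spc[OF this, of 0]] show "{t. y(i := t) \<in> K} \<in> sets lborel" by simp
      qed
      finally show ?thesis .
    qed
    have sum_split: "(\<Sum>j\<in>I. f j) = f i + (\<Sum>j\<in>?J. f j)" for f :: "'i \<Rightarrow> real"
      using fin i by (rule sum.remove)
    show "(\<Sum>j\<in>I. (x j - y j)\<^sup>2) \<le> D\<^sup>2" if xy: "x \<in> K'" "y \<in> K'" for x y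
    proof -
      define q where "q = D\<^sup>2 - (\<Sum>j\<in>?J. (x j - y j)\<^sup>2)"
      have pos: "0 < m x" "0 < m y"
        using xy by (auto simp: K'_def intro: le_less_trans[rotated])
      have ne: "{t. x(i := t) \<in> K} \<noteq> {}" "{t. y(i := t) \<in> K} \<noteq> {}"
        using pos unfolding m_def by (metis emeasure_empty less_irrefl)+
      have st: "(s - t)\<^sup>2 \<le> q" if "x(i := s) \<in> K" "y(i := t) \<in> K" for s t
        using diam[OF that] by (simp add: sum_split q_def)
      have q0: "0 \<le> q" using ne st by (force intro: order_trans[OF zero_le_power2])
      have "m x + m y \<le> ennreal (2 * sqrt q)"
        unfolding m_def
      proof (rule emeasure_add_le_of_mutual_dist[OF ne])
        fix s t assume "s \<in> {t. x(i := t) \<in> K}" "t \<in> {t. y(i := t) \<in> K}"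
        then have "(s - t)\<^sup>2 \<le> q" by (intro st) auto
        then show "\<bar>s - t\<bar> \<le> sqrt q" using real_sqrt_le_mono by fastforce
      qed
      moreover have "ennreal (2 * \<bar>x i\<bar>) + ennreal (2 * \<bar>y i\<bar>) \<le> m x + m y"
        using xy by (intro add_mono) (auto simp: K'_def)
      ultimately have "ennreal (2 * \<bar>x i\<bar> + 2 * \<bar>y i\<bar>) \<le> ennreal (2 * sqrt q)"
        by (simp add: ennreal_plus[symmetric] del: ennreal_plus)
      then have "\<bar>x i\<bar> + \<bar>y i\<bar> \<le> sqrt q"
        using q0 by (simp add: ennreal_le_iff del: ennreal_plus)
      then have "\<bar>x i - y i\<bar> \<le> sqrt q" by linarith
      then have "(x i - y i)\<^sup>2 \<le> q"
        using q0 by (metis abs_ge_zero power2_abs power_mono real_sqrt_pow2)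
      then show ?thesis by (simp add: sum_split q_def)
    qed
    show "x(i := - x i) \<in> K'" if "x \<in> K'" for x
      using that i by (auto simp: K'_def m_upd space_PiM PiE_iff extensional_def)
    show "x(j := - x j) \<in> K'"
      if j: "j \<in> I" and sym: "\<And>x. x \<in> K \<Longrightarrow> x(j := - x j) \<in> K" and x: "x \<in> K'" for j x
    proof (cases "j = i")
      case True
      then show ?thesis
        using x i by (auto simp: K'_def m_upd space_PiM PiE_iff extensional_def)
    next
      case False
      have "x(i := t, j := - x j) \<in> K \<longleftrightarrow> x(i := t) \<in> K" for t
      proof -
        have "x(i := t, j := x j) = x(i := t)" using False by auto
        then show ?thesis
          using sym[of "x(i := t)"] sym[of "x(i := t, j := - x j)"] False by auto
      qed
      then have "m (x(j := - x j)) = m x"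
        using False by (simp add: m_def fun_upd_twist)
      then show ?thesis
        using x j False by (auto simp: K'_def space_PiM PiE_iff extensional_def)
    qed
  qed
qed

text \<open>
  Symmetrizing in all coordinate directions yields a set with \<open>K = -K\<close>, in which a point \<open>x\<close> has
  distance \<open>2 |x|\<close> from \<open>-x\<close>; so it lies in the ball of radius \<open>D / 2\<close>. The dimension
  is the cardinality of an index set and not a type, so that the result can be used in
  hyperplanes.
\<close>

theorem isodiametric_inequality_PiM:
  fixes K :: "('i \<Rightarrow> real) set"
  assumes fin: "finite I" and K: "K \<in> sets (Pi\<^sub>M I (\<lambda>_. lborel))" and D: "0 \<le> D"
    and diam: "\<And>x y. x \<in> K \<Longrightarrow> y \<in> K \<Longrightarrow> (\<Sum>j\<in>I. (x j - y j)\<^sup>2) \<le> D\<^sup>2"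
  shows "emeasure (Pi\<^sub>M I (\<lambda>_. lborel)) K \<le> ennreal (unit_ball_vol (card I) * (D / 2) ^ card I)"
proof -
  let ?P = "Pi\<^sub>M I (\<lambda>_. lborel :: real measure)"
  have "\<exists>K'. K' \<in> sets ?P \<and> emeasure ?P K' = emeasure ?P K \<and>
      (\<forall>x\<in>K'. \<forall>y\<in>K'. (\<Sum>j\<in>I. (x j - y j)\<^sup>2) \<le> D\<^sup>2) \<and> (\<forall>j\<in>J. \<forall>x\<in>K'. x(j := - x j) \<in> K')"
    if "J \<subseteq> I" for J
    using finite_subset[OF that fin] that
  proof (induction J rule: finite_induct)
    case empty
    then show ?case using K diam by blast
  next
    case (insert i J)
    then have "J \<subseteq> I" by simp
    from insert.IH[OF this] obtain L where L: "L \<in> sets ?P" "emeasure ?P L = emeasure ?P K"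
      "\<And>x y. x \<in> L \<Longrightarrow> y \<in> L \<Longrightarrow> (\<Sum>j\<in>I. (x j - y j)\<^sup>2) \<le> D\<^sup>2"
      "\<And>j x. j \<in> J \<Longrightarrow> x \<in> L \<Longrightarrow> x(j := - x j) \<in> L" by blast
    from insert.prems have "i \<in> I" by simp
    obtain K' where K': "K' \<in> sets ?P" "emeasure ?P K' = emeasure ?P L"
        "\<And>x y. x \<in> K' \<Longrightarrow> y \<in> K' \<Longrightarrow> (\<Sum>j\<in>I. (x j - y j)\<^sup>2) \<le> D\<^sup>2"
        "\<And>x. x \<in> K' \<Longrightarrow> x(i := - x i) \<in> K'"
        "\<And>j x. \<lbrakk>j \<in> I; \<And>x. x \<in> L \<Longrightarrow> x(j := - x j) \<in> L; x \<in> K'\<rbrakk> \<Longrightarrow> x(j := - x j) \<in> K'"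
      by (rule steiner_symmetrization[OF fin \<open>i \<in> I\<close> L(1,3)]) (assumption | blast)+
    have "x(j := - x j) \<in> K'" if "j \<in> insert i J" "x \<in> K'" for j x
    proof (cases "j = i")
      case False
      with that insert.prems have "j \<in> I" "j \<in> J" by auto
      with K'(5)[of j x] L(4)[of j] that show ?thesis by blast
    qed (use that K'(4) in auto)
    with K'(1-3) L(2) show ?case by (intro exI[of _ K'] conjI ballI) (simp_all del: fun_upd_apply)
  qed
  from this[OF order_refl] obtain K' where K': "K' \<in> sets ?P" "emeasure ?P K' = emeasure ?P K"
      "\<And>x y. x \<in> K' \<Longrightarrow> y \<in> K' \<Longrightarrow> (\<Sum>j\<in>I. (x j - y j)\<^sup>2) \<le> D\<^sup>2"
      "\<And>j x. j \<in> I \<Longrightarrow> x \<in> K' \<Longrightarrow> x(j := - x j) \<in> K'" by blast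
  have flip: "(\<lambda>j. if j \<in> J then - x j else x j) \<in> K'" if "J \<subseteq> I" "x \<in> K'" for J x
    using finite_subset[OF that(1) fin] that
  proof (induction J rule: finite_induct)
    case (insert i J)
    then have "(\<lambda>j. if j \<in> J then - x j else x j)(i := - x i) \<in> K'"
      using K'(4)[of i "\<lambda>j. if j \<in> J then - x j else x j"] by simp
    also have "(\<lambda>j. if j \<in> J then - x j else x j)(i := - x i) = (\<lambda>j. if j \<in> insert i J then - x j else x j)"
      by auto
    finally show ?case .
  qed simp
  have ball: "sqrt (\<Sum>j\<in>I. (x j)\<^sup>2) \<le> D / 2" if "x \<in> K'" for x
  proof -
    have "(\<Sum>j\<in>I. (x j - (- x j))\<^sup>2) \<le> D\<^sup>2"
      using K'(3)[OF that flip[OF order_refl that]] by simp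
    also have "(\<Sum>j\<in>I. (x j - (- x j))\<^sup>2) = 4 * (\<Sum>j\<in>I. (x j)\<^sup>2)"
      by (simp add: sum_distrib_left power_mult_distrib flip: mult_2)
    finally have "(\<Sum>j\<in>I. (x j)\<^sup>2) \<le> (D / 2)\<^sup>2" by (simp add: power_divide)
    then show ?thesis using D by (intro real_le_lsqrt) (auto intro: sum_nonneg)
  qed
  \<comment> \<open>Strictly larger radii include the degenerate case \<open>D = 0\<close>, where the ball has radius \<open>0\<close>.\<close>
  have "emeasure ?P K \<le> ennreal (unit_ball_vol (card I) * R ^ card I)" if "D / 2 < R" for R
  proof -
    have "R > 0" using that D by simp
    have "K' \<subseteq> {f. sqrt (\<Sum>i\<in>I. (f i)\<^sup>2) \<le> R} \<inter> space ?P"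
      using sets.sets_into_space[OF K'(1)] ball that by force
    moreover have "{f. sqrt (\<Sum>i\<in>I. (f i)\<^sup>2) \<le> R} \<inter> space ?P \<in> sets ?P"
      using fin by measurable
    ultimately show ?thesis
      using emeasure_mono[of K' "{f. sqrt (\<Sum>i\<in>I. (f i)\<^sup>2) \<le> R} \<inter> space ?P" ?P]
        emeasure_cball_aux[OF fin \<open>R > 0\<close>] K'(2) by simp
  qed
  moreover have "((\<lambda>R. ennreal (unit_ball_vol (card I) * R ^ card I)) \<longlongrightarrow>
      ennreal (unit_ball_vol (card I) * (D / 2) ^ card I)) (at_right (D / 2))"
    by (intro tendsto_ennrealI tendsto_intros)
  ultimately show ?thesis
    by (intro tendsto_lowerbound[of _ _ "at_right (D / 2)"])
      (auto simp: eventually_at_right_less intro!: eventually_at_rightI[of _ "D / 2 + 1"] simp: eventually_at_filter)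
qed

section \<open>Vitali coverings and orthogonal invariance of Lebesgue measure\<close>

text \<open>
  Radius \<open>-1\<close>, i.e. an empty ball, fills up the sequence when the family is finite.
\<close>

lemma enumerate_balls:
  fixes C :: "('a::metric_space \<times> real) set"
  assumes C: "countable C" and pos: "\<And>i. i \<in> C \<Longrightarrow> 0 < snd i"
    and disj: "pairwise (\<lambda>i j. disjnt (cball (fst i) (snd i)) (cball (fst j) (snd j))) C"
  obtains x r where "\<And>n::nat. (x n, r n) \<in> C \<or> r n = -1"
    "\<And>i. i \<in> C \<Longrightarrow> \<exists>n. i = (x n, r n)"
    "disjoint_family (\<lambda>n. cball (x n) (r n))"
proof -
  define p where "p n = (if n \<in> to_nat_on C ` C then from_nat_into C n else (undefined, -1))" for n
  have inC: "p n \<in> C" if "n \<in> to_nat_on C ` C" for n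
    using that C by (auto simp: p_def)
  have out: "snd (p n) = -1" if "n \<notin> to_nat_on C ` C" for n
    using that by (simp add: p_def)
  have inj: "n = m" if "n \<in> to_nat_on C ` C" "m \<in> to_nat_on C ` C" "p n = p m" for n m
    using that C by (auto simp: p_def)
  show ?thesis
  proof (rule that[of "\<lambda>n. fst (p n)" "\<lambda>n. snd (p n)"])
    show "(fst (p n), snd (p n)) \<in> C \<or> snd (p n) = -1" for n
      using inC[of n] out[of n] by auto
    show "\<exists>n. i = (fst (p n), snd (p n))" if "i \<in> C" for i
      using that C by (intro exI[of _ "to_nat_on C i"]) (simp add: p_def)
    show "disjoint_family (\<lambda>n. cball (fst (p n)) (snd (p n)))"
      unfolding disjoint_family_on_def
    proof (intro ballI impI)
      fix n m :: nat assume "n \<noteq> m"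
      show "cball (fst (p n)) (snd (p n)) \<inter> cball (fst (p m)) (snd (p m)) = {}"
      proof (cases "n \<in> to_nat_on C ` C \<and> m \<in> to_nat_on C ` C")
        case True
        then have "p n \<in> C" "p m \<in> C" "p n \<noteq> p m" using inC inj \<open>n \<noteq> m\<close> by blast+
        from pairwiseD[OF disj this] show ?thesis by (simp add: disjnt_def)
      next
        case False
        then have "snd (p n) = -1 \<or> snd (p m) = -1" using out by blast
        then show ?thesis by auto
      qed
    qed
  qed
qed

lemma Vitali_disjoint_balls_in_open:
  fixes U :: "'a::euclidean_space set"
  assumes "open U" "0 < \<delta>"
  obtains x :: "nat \<Rightarrow> 'a" and r :: "nat \<Rightarrow> real" where
    "\<And>n. r n < \<delta>" "\<And>n. cball (x n) (r n) \<subseteq> U"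
    "disjoint_family (\<lambda>n. cball (x n) (r n))"
    "negligible (U - (\<Union>n. cball (x n) (r n)))"
proof -
  let ?K = "{(x, r). 0 < r \<and> r < \<delta> \<and> cball x r \<subseteq> U} :: ('a \<times> real) set"
  have *: "\<exists>i. i \<in> ?K \<and> x \<in> cball (fst i) (snd i) \<and> snd i < d" if x: "x \<in> U" "0 < d" for x d
  proof -
    obtain e where "e > 0" "cball x e \<subseteq> U"
      using \<open>open U\<close> x by (meson open_contains_cball)
    then show ?thesis
      using x \<open>0 < \<delta>\<close> by (intro exI[of _ "(x, min e (min (d / 2) (\<delta> / 2)))"]) (auto simp: subset_iff)
  qed
  obtain C where C: "countable C" "C \<subseteq> ?K"
      "pairwise (\<lambda>i j. disjnt (cball (fst i) (snd i)) (cball (fst j) (snd j))) C"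
      "negligible (U - (\<Union>i\<in>C. cball (fst i) (snd i)))"
  proof (rule Vitali_covering_theorem_cballs[of ?K snd U fst])
    show "0 < snd i" if "i \<in> ?K" for i using that by auto
  qed (rule *, assumption+)
  have pos: "0 < snd i" if "i \<in> C" for i using C(2) that by auto
  obtain x r where xr: "\<And>n::nat. (x n, r n) \<in> C \<or> r n = -1"
    "\<And>i. i \<in> C \<Longrightarrow> \<exists>n. i = (x n, r n)" "disjoint_family (\<lambda>n. cball (x n) (r n))"
    by (rule enumerate_balls[OF C(1) _ C(3)], erule pos, rule that)
  have K: "(x n, r n) \<in> ?K \<or> r n = -1" for n
    using xr(1)[of n] C(2) by blast
  show ?thesis
  proof (rule that)
    show "r n < \<delta>" for n using K[of n] \<open>0 < \<delta>\<close> by auto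
    show "cball (x n) (r n) \<subseteq> U" for n using K[of n] by auto
    have "(\<Union>i\<in>C. cball (fst i) (snd i)) \<subseteq> (\<Union>n. cball (x n) (r n))"
      using xr(2) by fastforce
    then show "negligible (U - (\<Union>n. cball (x n) (r n)))"
      by (intro negligible_subset[OF C(4)]) blast
  qed (rule xr(3))
qed

lemma Vitali_enlarged_balls_cover:
  fixes U :: "'a::euclidean_space set"
  assumes "open U" "0 < \<delta>"
  obtains x :: "nat \<Rightarrow> 'a" and r :: "nat \<Rightarrow> real" where
    "\<And>n. r n \<le> \<delta>" "\<And>n. cball (x n) (r n) \<subseteq> U"
    "disjoint_family (\<lambda>n. cball (x n) (r n))"
    "U \<subseteq> (\<Union>n. cball (x n) (5 * r n))"
proof -
  let ?K = "{(x, r). 0 < r \<and> r \<le> \<delta> \<and> cball x r \<subseteq> U} :: ('a \<times> real) set"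
  have *: "U \<subseteq> (\<Union>i\<in>?K. cball (fst i) (snd i))"
  proof
    fix x assume "x \<in> U"
    then obtain e where "e > 0" "cball x e \<subseteq> U"
      using \<open>open U\<close> by (meson open_contains_cball)
    then have "(x, min e \<delta>) \<in> ?K" "x \<in> cball (fst (x, min e \<delta>)) (snd (x, min e \<delta>))"
      using \<open>0 < \<delta>\<close> by (auto simp: subset_iff)
    then show "x \<in> (\<Union>i\<in>?K. cball (fst i) (snd i))" by blast
  qed
  obtain C where C: "countable C" "C \<subseteq> ?K"
      "pairwise (\<lambda>i j. disjnt (cball (fst i) (snd i)) (cball (fst j) (snd j))) C"
      "U \<subseteq> (\<Union>i\<in>C. cball (fst i) (5 * snd i))"
  proof (rule Vitali_covering_lemma_cballs[OF *, of \<delta>])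
    show "0 < snd i \<and> snd i \<le> \<delta>" if "i \<in> ?K" for i using that by auto
  qed
  have pos: "0 < snd i" if "i \<in> C" for i using C(2) that by auto
  obtain x r where xr: "\<And>n::nat. (x n, r n) \<in> C \<or> r n = -1"
    "\<And>i. i \<in> C \<Longrightarrow> \<exists>n. i = (x n, r n)" "disjoint_family (\<lambda>n. cball (x n) (r n))"
    by (rule enumerate_balls[OF C(1) _ C(3)], erule pos, rule that)
  have K: "(x n, r n) \<in> ?K \<or> r n = -1" for n
    using xr(1)[of n] C(2) by blast
  show ?thesis
  proof (rule that)
    show "r n \<le> \<delta>" for n using K[of n] \<open>0 < \<delta>\<close> by auto
    show "cball (x n) (r n) \<subseteq> U" for n using K[of n] by auto
    have "(\<Union>i\<in>C. cball (fst i) (5 * snd i)) \<subseteq> (\<Union>n. cball (x n) (5 * r n))"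
      using xr(2) by fastforce
    with C(4) show "U \<subseteq> (\<Union>n. cball (x n) (5 * r n))" by blast
  qed (rule xr(3))
qed

lemma suminf_disjoint_cballs_le:
  fixes U :: "'a::euclidean_space set"
  assumes "open U" "\<And>n. cball (x n) (r n) \<subseteq> U" "disjoint_family (\<lambda>n. cball (x n) (r n))"
  shows "(\<Sum>n. emeasure lborel (cball (x n) (r n))) \<le> emeasure lborel U"
proof -
  have "(\<Sum>n. emeasure lborel (cball (x n) (r n))) = emeasure lborel (\<Union>n. cball (x n) (r n))"
    using assms by (intro suminf_emeasure) auto
  also have "\<dots> \<le> emeasure lborel U"
    using assms by (intro emeasure_mono) auto
  finally show ?thesis .
qed

text \<open>
  Balls are mapped to balls of the same radius, and disjoint balls exhaust an open set up to a null set.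
\<close>

lemma emeasure_orthogonal_image_open_le:
  fixes f :: "'a::euclidean_space \<Rightarrow> 'a"
  assumes f: "orthogonal_transformation f" and U: "open U"
  shows "emeasure lebesgue (f ` U) \<le> emeasure lebesgue U"
proof -
  obtain x r where xr: "\<And>n. r n < 1" "\<And>n. cball (x n) (r n) \<subseteq> U"
    "disjoint_family (\<lambda>n::nat. cball (x n) (r n))"
    "negligible (U - (\<Union>n. cball (x n) (r n)))"
    by (rule Vitali_disjoint_balls_in_open[OF U, of 1]) (simp, blast)
  let ?N = "U - (\<Union>n. cball (x n) (r n))"
  have N: "negligible (f ` ?N)"
    using xr(4) f
    by (intro negligible_differentiable_image_negligible)
      (auto intro!: linear_imp_differentiable_on orthogonal_transformation_linear)
  then have N_sets: "f ` ?N \<in> sets lebesgue" by (rule negligible_imp_sets)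
  have im: "f ` cball (x n) (r n) = cball (f (x n)) (r n)" for n
    using image_orthogonal_transformation_cball[OF f] .
  have "f ` U \<subseteq> f ` ?N \<union> (\<Union>n. cball (f (x n)) (r n))"
    unfolding im[symmetric] by auto
  then have "emeasure lebesgue (f ` U) \<le> emeasure lebesgue (f ` ?N \<union> (\<Union>n. cball (f (x n)) (r n)))"
    using N_sets by (intro emeasure_mono) auto
  also have "\<dots> \<le> emeasure lebesgue (f ` ?N) + emeasure lebesgue (\<Union>n. cball (f (x n)) (r n))"
    using N_sets by (intro emeasure_subadditive) auto
  also have "emeasure lebesgue (f ` ?N) = 0"
    using negligible_iff_emeasure0[OF N_sets] N by blast
  also have "emeasure lebesgue (\<Union>n. cball (f (x n)) (r n)) \<le> (\<Sum>n. emeasure lebesgue (cball (f (x n)) (r n)))"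
    by (rule emeasure_subadditive_countably) auto
  also have "\<dots> = (\<Sum>n. emeasure lborel (cball (x n) (r n)))"
  proof (rule suminf_cong)
    show "emeasure lebesgue (cball (f (x n)) (r n)) = emeasure lborel (cball (x n) (r n))" for n
      by (cases "0 \<le> r n") (simp_all add: emeasure_cball)
  qed
  also have "\<dots> \<le> emeasure lborel U"
    using xr U by (intro suminf_disjoint_cballs_le) auto
  finally show ?thesis using U by simp
qed

lemma le_emeasure_lebesgueI_open:
  fixes S :: "'a::euclidean_space set"
  assumes "S \<in> sets lebesgue" and le: "\<And>U. open U \<Longrightarrow> S \<subseteq> U \<Longrightarrow> m \<le> emeasure lebesgue U"
  shows "m \<le> emeasure lebesgue S"
proof (rule ennreal_le_epsilon)
  fix e :: real assume "0 < e"
  obtain T where T: "open T" "S \<subseteq> T" "T - S \<in> lmeasurable" "emeasure lebesgue (T - S) < ennreal e"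
    using sets_lebesgue_outer_open[OF assms(1) \<open>0 < e\<close>] by metis
  have "m \<le> emeasure lebesgue T" using T le by blast
  also have "\<dots> \<le> emeasure lebesgue (S \<union> (T - S))"
    using T assms(1) by (intro emeasure_mono) auto
  also have "\<dots> \<le> emeasure lebesgue S + emeasure lebesgue (T - S)"
    using T assms(1) by (intro emeasure_subadditive) auto
  also have "\<dots> \<le> emeasure lebesgue S + ennreal e"
    using T by (intro add_left_mono) auto
  finally show "m \<le> emeasure lebesgue S + ennreal e" .
qed

lemma emeasure_le_orthogonal_image:
  fixes f :: "'a::euclidean_space \<Rightarrow> 'a"
  assumes f: "orthogonal_transformation f" and S: "compact S"
  shows "emeasure lebesgue S \<le> emeasure lebesgue (f ` S)"
proof (rule le_emeasure_lebesgueI_open)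
  have "compact (f ` S)"
    using S orthogonal_transformation_linear[OF f]
    by (intro compact_continuous_image linear_continuous_on) (simp_all add: linear_conv_bounded_linear)
  from borel_compact[OF this] show "f ` S \<in> sets lebesgue" by simp
  fix U assume U: "open U" "f ` S \<subseteq> U"
  have g: "orthogonal_transformation (inv f)"
    using f by (rule orthogonal_transformation_inv)
  have "S = inv f ` f ` S"
    using f by (simp add: image_image orthogonal_transformation_inj)
  also have "\<dots> \<subseteq> inv f ` U" using U by blast
  finally have "emeasure lebesgue S \<le> emeasure lebesgue (inv f ` U)"
  proof (rule emeasure_mono)
    have "open (inv f ` U)"
      using U g by (meson open_surjective_linear_image orthogonal_transformation_linear orthogonal_transformation_surj)
    then show "inv f ` U \<in> sets lebesgue" by auto
  qed
  also have "\<dots> \<le> emeasure lebesgue U"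
    by (rule emeasure_orthogonal_image_open_le[OF g U(1)])
  finally show "emeasure lebesgue S \<le> emeasure lebesgue U" .
qed

section \<open>Volume from the diameters of parallel slices\<close>

text \<open>
  Fubini, with the isodiametric inequality bounding the area of each slice.
\<close>

lemma emeasure_le_of_slices_Basis:
  fixes S :: "'a::euclidean_space set"
  assumes S: "S \<in> sets borel" and b0: "b\<^sub>0 \<in> Basis" and D: "0 \<le> D"
    and height: "\<And>x. x \<in> S \<Longrightarrow> x \<bullet> b\<^sub>0 \<in> {\<alpha>..\<beta>}"
    and slice: "\<And>x y. x \<in> S \<Longrightarrow> y \<in> S \<Longrightarrow> x \<bullet> b\<^sub>0 = y \<bullet> b\<^sub>0 \<Longrightarrow> dist x y \<le> D"
  shows "emeasure lborel S \<le> ennreal (\<beta> - \<alpha>) *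
           ennreal (unit_ball_vol (real (DIM('a) - 1)) * (D / 2) ^ (DIM('a) - 1))"
proof -
  define I where "I = (Basis :: 'a set) - {b\<^sub>0}"
  define V where "V = ennreal (unit_ball_vol (real (DIM('a) - 1)) * (D / 2) ^ (DIM('a) - 1))"
  define g where "g f = (\<Sum>b\<in>Basis. f b *\<^sub>R b)" for f :: "'a \<Rightarrow> real"
  let ?P = "Pi\<^sub>M (Basis :: 'a set) (\<lambda>_. lborel :: real measure)"
  let ?PI = "Pi\<^sub>M I (\<lambda>_. lborel :: real measure)"
  interpret product_sigma_finite "\<lambda>_::'a. lborel :: real measure" ..
  have ins: "insert b\<^sub>0 I = Basis" "b\<^sub>0 \<notin> I" and fin: "finite I"
    using b0 by (auto simp: I_def)
  have card: "card I = DIM('a) - 1" using b0 by (simp add: I_def)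
  have g_meas [measurable]: "g \<in> measurable ?P borel"
    unfolding g_def by measurable
  have g_inner: "g f \<bullet> b = f b" if "b \<in> Basis" for f b
    using that by (simp add: g_def)
  define S' where "S' = g -` S \<inter> space ?P"
  have S': "S' \<in> sets ?P" unfolding S'_def using g_meas S by (rule measurable_sets)
  have upd: "(\<lambda>x. x(b\<^sub>0 := c)) \<in> measurable ?PI ?P" for c
  proof -
    have "(\<lambda>(f, y). f(b\<^sub>0 := y)) \<in> measurable (?PI \<Otimes>\<^sub>M lborel) ?P"
      using measurable_add_dim[of b\<^sub>0 I "\<lambda>_. lborel :: real measure"] ins by simp
    from measurable_compose[OF measurable_Pair2'[of c lborel ?PI] this] show ?thesis by simp
  qed
  have inner: "(\<integral>\<^sup>+ x. indicator S' (x(b\<^sub>0 := c)) \<partial>?PI) \<le> V * indicator {\<alpha>..\<beta>} c" for c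
  proof (cases "c \<in> {\<alpha>..\<beta>}")
    case False
    have "x(b\<^sub>0 := c) \<notin> S'" for x
      using height[of "g (x(b\<^sub>0 := c))"] g_inner[OF b0, of "x(b\<^sub>0 := c)"] False by (auto simp: S'_def)
    then show ?thesis by simp
  next
    case True
    define K where "K = (\<lambda>x. x(b\<^sub>0 := c)) -` S' \<inter> space ?PI"
    have K: "K \<in> sets ?PI" unfolding K_def by (rule measurable_sets[OF upd S'])
    have "(\<integral>\<^sup>+ x. indicator S' (x(b\<^sub>0 := c)) \<partial>?PI) = (\<integral>\<^sup>+ x. indicator K x \<partial>?PI)"
      by (rule nn_integral_cong) (auto simp: K_def indicator_def)
    also have "\<dots> = emeasure ?PI K" using K by simp
    also have "\<dots> \<le> V"
      unfolding V_def card[symmetric]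
    proof (rule isodiametric_inequality_PiM[OF fin K D])
      fix x y assume xy: "x \<in> K" "y \<in> K"
      let ?x = "x(b\<^sub>0 := c)" and ?y = "y(b\<^sub>0 := c)"
      have "dist (g ?x) (g ?y) \<le> D"
        using xy by (intro slice) (auto simp: K_def S'_def g_inner[OF b0])
      then have "(dist (g ?x) (g ?y))\<^sup>2 \<le> D\<^sup>2" by (intro power_mono) auto
      also have "(dist (g ?x) (g ?y))\<^sup>2 = (\<Sum>b\<in>Basis. (?x b - ?y b)\<^sup>2)"
        by (simp add: euclidean_dist_l2[of "g ?x"] L2_set_def g_inner dist_real_def sum_nonneg del: fun_upd_apply)
      also have "\<dots> = (\<Sum>b\<in>I. (?x b - ?y b)\<^sup>2)"
        using ins fin by (simp add: sum.insert flip: ins(1))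
      also have "\<dots> = (\<Sum>b\<in>I. (x b - y b)\<^sup>2)"
        using ins by (intro sum.cong) auto
      finally show "(\<Sum>b\<in>I. (x b - y b)\<^sup>2) \<le> D\<^sup>2" .
    qed
    finally show ?thesis using True by simp
  qed
  have "emeasure lborel S = emeasure ?P S'"
    unfolding S'_def g_def
    by (subst lborel_eq, subst emeasure_distr) (use S in \<open>auto simp: g_def\<close>)
  also have "\<dots> = (\<integral>\<^sup>+ x. indicator S' x \<partial>?P)" using S' by simp
  also have "\<dots> = (\<integral>\<^sup>+ c. (\<integral>\<^sup>+ x. indicator S' (x(b\<^sub>0 := c)) \<partial>?PI) \<partial>lborel)"
    using product_nn_integral_insert_rev[of I b\<^sub>0 "indicator S'"] ins fin S' by simp
  also have "\<dots> \<le> (\<integral>\<^sup>+ c. V * indicator {\<alpha>..\<beta>} c \<partial>lborel)"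
    by (intro nn_integral_mono inner)
  also have "\<dots> = V * emeasure lborel {\<alpha>..\<beta>}"
    by (simp add: nn_integral_cmult_indicator)
  also have "emeasure lborel {\<alpha>..\<beta>} = ennreal (\<beta> - \<alpha>)"
    by (cases "\<alpha> \<le> \<beta>") (auto simp: ennreal_neg)
  finally show ?thesis by (simp add: V_def mult.commute)
qed

text \<open>
  Rotating \<open>e\<close> to a coordinate axis reduces this to the previous lemma.
\<close>

lemma emeasure_le_of_slices:
  fixes S :: "(real ^ 'n) set"
  assumes S: "compact S" and e: "norm e = 1" and D: "0 \<le> D"
    and height: "\<And>x. x \<in> S \<Longrightarrow> x \<bullet> e \<in> {\<alpha>..\<beta>}"
    and slice: "\<And>x y. x \<in> S \<Longrightarrow> y \<in> S \<Longrightarrow> x \<bullet> e = y \<bullet> e \<Longrightarrow> dist x y \<le> D"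
  shows "emeasure lborel S \<le> ennreal (\<beta> - \<alpha>) *
           ennreal (unit_ball_vol (real (CARD('n) - 1)) * (D / 2) ^ (CARD('n) - 1))"
proof -
  fix k :: 'n
  obtain g :: "real ^ 'n \<Rightarrow> real ^ 'n" where g: "orthogonal_transformation g" "g e = axis k 1"
  proof (rule orthogonal_transformation_exists_1[OF e norm_axis_1[of k]])
    fix f :: "real ^ 'n \<Rightarrow> real ^ 'n"
    assume "orthogonal_transformation f" "f e = axis k 1"
    then show thesis by (rule that)
  qed
  have inner: "g x \<bullet> axis k 1 = x \<bullet> e" for x
    using g(1) unfolding orthogonal_transformation_def g(2)[symmetric] by blast
  have compact: "compact (g ` S)"
    using S orthogonal_transformation_linear[OF g(1)]
    by (intro compact_continuous_image linear_continuous_on) (simp_all add: linear_conv_bounded_linear)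
  have "emeasure lborel S = emeasure lebesgue S"
    using borel_compact[OF S] by simp
  also have "\<dots> \<le> emeasure lebesgue (g ` S)"
    by (rule emeasure_le_orthogonal_image[OF g(1) S])
  also have "\<dots> = emeasure lborel (g ` S)"
    using borel_compact[OF compact] by simp
  also have "\<dots> \<le> ennreal (\<beta> - \<alpha>) *
           ennreal (unit_ball_vol (real (DIM(real ^ 'n) - 1)) * (D / 2) ^ (DIM(real ^ 'n) - 1))"
  proof (rule emeasure_le_of_slices_Basis[OF borel_compact[OF compact] _ D])
    show "axis k 1 \<in> (Basis :: (real ^ 'n) set)" by (simp add: axis_in_Basis_iff)
    show "y \<bullet> axis k 1 \<in> {\<alpha>..\<beta>}" if "y \<in> g ` S" for y
      using that height by (auto simp: inner)
    show "dist x y \<le> D" if "x \<in> g ` S" "y \<in> g ` S" "x \<bullet> axis k 1 = y \<bullet> axis k 1" for x y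
      using that slice orthogonal_transformation_isometry[of g] g(1) by (auto simp: inner)
  qed
  finally show ?thesis by simp
qed

section \<open>Hausdorff measure in full dimension is at most Lebesgue measure\<close>

lemma hausdorff_content_le_cover:
  assumes "\<And>j. bounded (B j) \<and> diameter (B j) \<le> \<delta>" "S \<subseteq> (\<Union>j::nat. B j)"
  shows "hausdorff_content k \<delta> S \<le> ennreal (unit_ball_vol (real k) / 2 ^ k) *
           (\<Sum>j. if B j = {} then 0 else ennreal (diameter (B j) ^ k))"
  unfolding hausdorff_content_def
  by (intro mult_left_mono INF_lower) (use assms in auto)

lemma hausdorff_content_le_balls:
  fixes S :: "'a::euclidean_space set"
  assumes "\<And>n. 2 * r n \<le> \<delta>" "0 \<le> \<delta>" "S \<subseteq> (\<Union>n::nat. cball (x n) (r n))"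
  shows "hausdorff_content DIM('a) \<delta> S \<le> (\<Sum>n. emeasure lborel (cball (x n) (r n)))"
proof -
  let ?c = "unit_ball_vol (real DIM('a)) / 2 ^ DIM('a)"
  have "hausdorff_content DIM('a) \<delta> S \<le> ennreal ?c *
      (\<Sum>n. if cball (x n) (r n) = {} then 0 else ennreal (diameter (cball (x n) (r n)) ^ DIM('a)))"
    using assms by (intro hausdorff_content_le_cover) auto
  also have "\<dots> = (\<Sum>n. ennreal ?c *
      (if cball (x n) (r n) = {} then 0 else ennreal (diameter (cball (x n) (r n)) ^ DIM('a))))"
    by (rule ennreal_suminf_cmult[symmetric])
  also have "\<dots> = (\<Sum>n. emeasure lborel (cball (x n) (r n)))"
  proof (rule suminf_cong)
    show "ennreal ?c * (if cball (x n) (r n) = {} then 0 else ennreal (diameter (cball (x n) (r n)) ^ DIM('a)))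
        = emeasure lborel (cball (x n) (r n))" for n
      by (cases "0 \<le> r n")
        (simp_all add: emeasure_cball power_mult_distrib power_divide flip: ennreal_mult)
  qed
  finally show ?thesis .
qed

text \<open>
  Covers are sequences; this bounds the cost of merging two of them.
\<close>

lemma suminf_interleave_le:
  fixes f g :: "nat \<Rightarrow> ennreal"
  shows "(\<Sum>n. if even n then f (n div 2) else g (n div 2)) \<le> (\<Sum>n. f n) + (\<Sum>n. g n)"
    (is "suminf ?h \<le> _")
proof (rule suminf_le_const)
  fix n
  have dbl: "(\<Sum>j<2 * n. ?h j) = (\<Sum>j<n. f j) + (\<Sum>j<n. g j)" for n
    by (induction n) (simp_all add: algebra_simps)
  have "(\<Sum>j<n. ?h j) \<le> (\<Sum>j<2 * n. ?h j)"
    by (rule sum_mono2) auto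
  also have "\<dots> \<le> (\<Sum>n. f n) + (\<Sum>n. g n)"
    unfolding dbl by (intro add_mono sum_le_suminf) auto
  finally show "(\<Sum>j<n. ?h j) \<le> (\<Sum>n. f n) + (\<Sum>n. g n)" .
qed simp

text \<open>
  By the Vitali covering lemma an open neighbourhood of \<open>N\<close> of small measure contains disjoint
  balls that cover it when enlarged five times, and their total volume is small.
\<close>

lemma negligible_small_ball_cover:
  fixes N :: "'a::euclidean_space set"
  assumes N: "negligible N" and \<delta>: "0 < \<delta>" and "0 < e"
  obtains x :: "nat \<Rightarrow> 'a" and r :: "nat \<Rightarrow> real" where
    "\<And>n. r n \<le> \<delta>" "N \<subseteq> (\<Union>n. cball (x n) (r n))"
    "(\<Sum>n. emeasure lborel (cball (x n) (r n))) \<le> ennreal e"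
proof -
  have "0 < e / 5 ^ DIM('a)" using \<open>0 < e\<close> by simp
  from sets_lebesgue_outer_open[OF negligible_imp_sets[OF N] this]
  obtain U where U: "open U" "N \<subseteq> U" "emeasure lebesgue (U - N) < ennreal (e / 5 ^ DIM('a))"
    by metis
  have "emeasure lborel U = emeasure lebesgue U" using U(1) by simp
  also have "\<dots> = emeasure lebesgue (U - N)"
    using N U(1) by (intro emeasure_Diff_null_set[symmetric]) (auto simp: negligible_iff_null_sets)
  finally have eU: "emeasure lborel U \<le> ennreal (e / 5 ^ DIM('a))" using U(3) by simp
  obtain x :: "nat \<Rightarrow> 'a" and r where xr: "\<And>n. r n \<le> \<delta> / 5" "\<And>n. cball (x n) (r n) \<subseteq> U"
      "disjoint_family (\<lambda>n. cball (x n) (r n))" "U \<subseteq> (\<Union>n. cball (x n) (5 * r n))"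
    by (rule Vitali_enlarged_balls_cover[OF U(1), of "\<delta> / 5"]) (use \<delta> in auto)
  show ?thesis
  proof (rule that)
    show "5 * r n \<le> \<delta>" for n using xr(1)[of n] by simp
    show "N \<subseteq> (\<Union>n. cball (x n) (5 * r n))" using U(2) xr(4) by blast
    have "(\<Sum>n. emeasure lborel (cball (x n) (5 * r n))) =
        (\<Sum>n. ennreal (5 ^ DIM('a)) * emeasure lborel (cball (x n) (r n)))"
    proof (rule suminf_cong)
      show "emeasure lborel (cball (x n) (5 * r n)) = ennreal (5 ^ DIM('a)) * emeasure lborel (cball (x n) (r n))" for n
        by (cases "0 \<le> r n") (simp_all add: emeasure_cball power_mult_distrib mult_ac flip: ennreal_mult)
    qed
    also have "\<dots> = ennreal (5 ^ DIM('a)) * (\<Sum>n. emeasure lborel (cball (x n) (r n)))"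
      by (rule ennreal_suminf_cmult)
    also have "\<dots> \<le> ennreal (5 ^ DIM('a)) * ennreal (e / 5 ^ DIM('a))"
      using suminf_disjoint_cballs_le[OF U(1) xr(2,3)] eU by (intro mult_left_mono) auto
    also have "\<dots> = ennreal e"
      using \<open>0 < e\<close> by (simp flip: ennreal_mult)
    finally show "(\<Sum>n. emeasure lborel (cball (x n) (5 * r n))) \<le> ennreal e" .
  qed
qed

text \<open>
  An open superset \<open>U\<close> is covered by disjoint balls in \<open>U\<close>, whose total volume is at most that of
  \<open>U\<close>, together with balls of negligible total volume. The normalization of the Hausdorff measure
  is such that a ball contributes precisely its volume.
\<close>

theorem hausdorff_measure_le_lebesgue:
  fixes S :: "'a::euclidean_space set"
  assumes "S \<in> sets lebesgue"
  shows "hausdorff_measure DIM('a) S \<le> emeasure lebesgue S"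
proof (rule le_emeasure_lebesgueI_open[OF assms])
  fix U assume U: "open U" "S \<subseteq> U"
  have "hausdorff_content DIM('a) \<delta> S \<le> emeasure lborel U + ennreal e"
    if pos: "0 < \<delta>" "0 < e" for \<delta> e :: real
  proof -
    have \<delta>: "0 < \<delta> / 2" using pos by simp
    obtain x :: "nat \<Rightarrow> 'a" and r where xr: "\<And>n. r n < \<delta> / 2" "\<And>n. cball (x n) (r n) \<subseteq> U"
        "disjoint_family (\<lambda>n. cball (x n) (r n))" "negligible (U - (\<Union>n. cball (x n) (r n)))"
      by (rule Vitali_disjoint_balls_in_open[OF U(1) \<delta>]) blast
    obtain y :: "nat \<Rightarrow> 'a" and q where yq: "\<And>n. q n \<le> \<delta> / 2"
        "U - (\<Union>n. cball (x n) (r n)) \<subseteq> (\<Union>n. cball (y n) (q n))"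
        "(\<Sum>n. emeasure lborel (cball (y n) (q n))) \<le> ennreal e"
      by (rule negligible_small_ball_cover[OF xr(4) \<delta> pos(2)]) blast
    define z where "z n = (if even n then x (n div 2) else y (n div 2))" for n
    define s where "s n = (if even n then r (n div 2) else q (n div 2))" for n
    have even: "z (2 * n) = x n" "s (2 * n) = r n" and odd: "z (2 * n + 1) = y n" "s (2 * n + 1) = q n" for n
      by (simp_all add: z_def s_def)
    have "(\<Union>n. cball (x n) (r n)) \<subseteq> (\<Union>j. cball (z j) (s j))"
    proof (rule UN_least)
      show "cball (x n) (r n) \<subseteq> (\<Union>j. cball (z j) (s j))" for n
        using UN_upper[of "2 * n" UNIV "\<lambda>j. cball (z j) (s j)"] by (simp only: even UNIV_I)
    qed
    moreover have "(\<Union>n. cball (y n) (q n)) \<subseteq> (\<Union>j. cball (z j) (s j))"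
    proof (rule UN_least)
      show "cball (y n) (q n) \<subseteq> (\<Union>j. cball (z j) (s j))" for n
        using UN_upper[of "2 * n + 1" UNIV "\<lambda>j. cball (z j) (s j)"] by (simp only: odd UNIV_I)
    qed
    ultimately have "(\<Union>n. cball (x n) (r n)) \<union> (\<Union>n. cball (y n) (q n)) \<subseteq> (\<Union>j. cball (z j) (s j))"
      by (rule Un_least)
    moreover have "S \<subseteq> (\<Union>n. cball (x n) (r n)) \<union> (\<Union>n. cball (y n) (q n))"
      using U(2) yq(2) unfolding Diff_subset_conv by (rule subset_trans)
    ultimately have cover: "S \<subseteq> (\<Union>j. cball (z j) (s j))" by (rule subset_trans[rotated])
    have "2 * s n \<le> \<delta>" for n
      using xr(1)[of "n div 2"] yq(1)[of "n div 2"] by (simp add: s_def)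
    then have "hausdorff_content DIM('a) \<delta> S \<le> (\<Sum>n. emeasure lborel (cball (z n) (s n)))"
      using pos(1) cover by (intro hausdorff_content_le_balls) auto
    also have "\<dots> = (\<Sum>n. if even n then emeasure lborel (cball (x (n div 2)) (r (n div 2)))
        else emeasure lborel (cball (y (n div 2)) (q (n div 2))))"
      by (rule suminf_cong) (simp add: z_def s_def)
    also have "\<dots> \<le> (\<Sum>n. emeasure lborel (cball (x n) (r n))) + (\<Sum>n. emeasure lborel (cball (y n) (q n)))"
      by (rule suminf_interleave_le)
    also have "\<dots> \<le> emeasure lborel U + ennreal e"
      by (intro add_mono suminf_disjoint_cballs_le[OF U(1) xr(2,3)] yq(3))
    finally show ?thesis .
  qed
  then have "hausdorff_content DIM('a) \<delta> S \<le> emeasure lborel U" if "0 < \<delta>" for \<delta>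
    by (rule ennreal_le_epsilon) (use that in simp)
  then show "hausdorff_measure DIM('a) S \<le> emeasure lebesgue U"
    unfolding hausdorff_measure_eq_SUP using U(1) by (intro SUP_least) simp
qed

section \<open>The tracks of the boundary cover the symmetric difference\<close>

definition slide :: "('a::real_vector \<Rightarrow> 'a) \<Rightarrow> real \<Rightarrow> 'a \<Rightarrow> 'a" where
  "slide f s x = x + s *\<^sub>R (f x - x)"

lemma slide_0 [simp]: "slide f 0 x = x" and slide_1 [simp]: "slide f 1 x = f x"
  by (simp_all add: slide_def)

lemma linear_slide: "linear f \<Longrightarrow> linear (slide f s)"
  by (auto simp: linear_iff slide_def algebra_simps)

lemma slide_translation: "slide (\<lambda>x. f x + t) s x = slide f s x + s *\<^sub>R t"
  by (simp add: slide_def algebra_simps)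

lemma norm_slide_le:
  assumes "orthogonal_transformation f" "s \<in> {0..1}"
  shows "norm (slide f s x) \<le> norm x"
proof -
  have "slide f s x = (1 - s) *\<^sub>R x + s *\<^sub>R f x" by (simp add: slide_def algebra_simps)
  also have "norm \<dots> \<le> (1 - s) * norm x + s * norm x"
    using assms by (intro norm_triangle_le) (auto simp: orthogonal_transformation_norm)
  finally show ?thesis by (simp add: algebra_simps)
qed

text \<open>
  \<open>(1 - s) x = - s (f x)\<close> forces \<open>(1 - s) |x| = s |x|\<close>.
\<close>

lemma inj_slide:
  assumes f: "orthogonal_transformation f" and s: "s \<in> {0..1}" "s \<noteq> 1 / 2"
  shows "inj (slide f s)"
proof -
  have "x = 0" if "slide f s x = 0" for x
  proof -
    have "(1 - s) *\<^sub>R x = - (s *\<^sub>R f x)" using that by (simp add: slide_def algebra_simps eq_neg_iff_add_eq_0)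
    then have "norm ((1 - s) *\<^sub>R x) = norm (s *\<^sub>R f x)" by simp
    then have "(1 - s) * norm x = s * norm x" using f s by (simp add: orthogonal_transformation_norm)
    then show "x = 0" using s by auto
  qed
  then show ?thesis
    using linear_injective_0[OF linear_slide[OF orthogonal_transformation_linear[OF f]]] by blast
qed

text \<open>
  The solution \<open>x\<close> of \<open>slide r s x = p\<close> persists near \<open>x\<close> for nearby times: the linear part stays
  bounded below by half its bound at time \<open>s\<close>, hence stays invertible, and the correction
  that has to be made to \<open>x\<close> is of order \<open>|s - s'|\<close>.
\<close>

lemma slide_solution_stable:
  fixes f :: "'a::euclidean_space \<Rightarrow> 'a"
  assumes f: "orthogonal_transformation f" and inj: "inj (slide f s)" and "open V" "x \<in> V"
  shows "\<exists>e>0. \<forall>s'. \<bar>s - s'\<bar> < e \<longrightarrow>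
           slide (\<lambda>x. f x + t) s x \<in> slide (\<lambda>x. f x + t) s' ` V"
proof -
  note lin = linear_slide[OF orthogonal_transformation_linear[OF f]]
  obtain B where B: "B > 0" "\<And>y. B * norm y \<le> norm (slide f s y)"
    using linear_inj_bounded_below_pos[OF lin inj] by (metis mult.commute)
  obtain \<rho> where \<rho>: "\<rho> > 0" "ball x \<rho> \<subseteq> V"
    using \<open>open V\<close> \<open>x \<in> V\<close> by (meson open_contains_ball)
  define c where "c = norm (f x + t - x)"
  \<comment> \<open>The first bound keeps the linear part injective, the second one keeps the new solution in \<open>V\<close>.\<close>
  define e where "e = min (B / 4) (B / 2 * \<rho> / (c + 1))"
  have c0: "c \<ge> 0" by (simp add: c_def)
  have "e > 0" using B \<rho> c0 by (auto simp: e_def)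
  moreover have "slide (\<lambda>x. f x + t) s x \<in> slide (\<lambda>x. f x + t) s' ` V" if s': "\<bar>s - s'\<bar> < e" for s'
  proof -
    have low: "B / 2 * norm y \<le> norm (slide f s' y)" for y
    proof -
      have "slide f s y = slide f s' y + (s - s') *\<^sub>R (f y - y)"
        by (simp add: slide_def algebra_simps)
      then have "norm (slide f s y) \<le> norm (slide f s' y) + \<bar>s - s'\<bar> * norm (f y - y)"
        by (metis norm_scaleR norm_triangle_ineq)
      also have "norm (f y - y) \<le> 2 * norm y"
        using norm_triangle_ineq4[of "f y" y] f by (simp add: orthogonal_transformation_norm)
      also have "\<bar>s - s'\<bar> * (2 * norm y) \<le> B / 4 * (2 * norm y)"
        using s' by (intro mult_right_mono) (auto simp: e_def)
      finally show ?thesis using B(2)[of y] by (simp add: mult_left_mono)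
    qed
    have "inj (slide f s')"
      using low B(1) unfolding linear_injective_0[OF lin]
      by (metis mult_le_0_iff half_gt_zero norm_le_zero_iff norm_zero not_less)
    then have "surj (slide f s')" using linear_inj_imp_surj[OF lin] by blast
    then obtain y where y: "slide f s' y = (s - s') *\<^sub>R (f x + t - x)"
      by (metis surjD)
    have "B / 2 * norm y \<le> \<bar>s - s'\<bar> * c"
      using low[of y] unfolding y by (simp add: c_def)
    also have "\<dots> \<le> \<bar>s - s'\<bar> * (c + 1)" by (intro mult_left_mono) auto
    also have "\<dots> < (B / 2 * \<rho> / (c + 1)) * (c + 1)"
      using s' c0 by (intro mult_strict_right_mono) (auto simp: e_def)
    also have "\<dots> = B / 2 * \<rho>" using c0 by (intro nonzero_eq_divide_eq[THEN iffD1]) auto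
    finally have "norm y < \<rho>" using B(1) by simp
    then have "x + y \<in> V" using \<rho> by (auto simp: subset_iff dist_norm)
    moreover have "slide (\<lambda>x. f x + t) s' (x + y) = slide (\<lambda>x. f x + t) s x"
      unfolding slide_translation linear_add[OF lin] y
      by (simp add: slide_def algebra_simps)
    ultimately show ?thesis by (metis image_eqI)
  qed
  ultimately show ?thesis by blast
qed

text \<open>
  Let \<open>Z\<close> be the set of times at which \<open>p\<close> lies in the image of the closure of \<open>A\<close>. It is closed by compactness.
  If no boundary point meets \<open>p\<close>, then the closure may be replaced by the interior, and \<open>Z\<close> is also open
  in the unit interval by \<open>slide_solution_stable\<close>. So \<open>p\<close> is covered at time \<open>0\<close> iff it is covered at time \<open>1\<close>.
  The null set \<open>N\<close> keeps the time \<open>1/2\<close> out of \<open>Z\<close> if the map is singular at that time.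
\<close>

lemma sym_diff_subset_sweep:
  fixes f :: "'a::euclidean_space \<Rightarrow> 'a"
  assumes A: "bounded A" and f: "orthogonal_transformation f" and r: "r = (\<lambda>x. f x + t)"
  obtains N where "negligible N" "sym_diff A (r ` A) \<subseteq> (\<Union>s\<in>{0..1}. slide r s ` frontier A) \<union> N"
proof
  \<comment> \<open>\<open>N\<close> is needed only if \<open>slide f (1/2)\<close> is singular; otherwise the range is the whole space.\<close>
  define N where "N = (if inj (slide f (1/2)) then {} else range (slide r (1/2)))"
  note lin = orthogonal_transformation_linear[OF f]
  show "negligible N"
  proof (cases "inj (slide f (1/2))")
    case False
    have "slide r (1/2) = (\<lambda>x. (1/2) *\<^sub>R t + slide f (1/2) x)"
      unfolding r slide_translation by (rule ext) (rule add.commute)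
    then have "N = (\<lambda>x. (1/2) *\<^sub>R t + x) ` range (slide f (1/2))"
      using False by (simp add: N_def image_image)
    then show ?thesis
      using negligible_linear_singular_image[OF linear_slide[OF lin] False] negligible_translation by metis
  qed (simp add: N_def)
  show "sym_diff A (r ` A) \<subseteq> (\<Union>s\<in>{0..1}. slide r s ` frontier A) \<union> N"
  proof (rule subsetI, rule ccontr)
    fix p assume p: "p \<in> sym_diff A (r ` A)" "p \<notin> (\<Union>s\<in>{0..1}. slide r s ` frontier A) \<union> N"
    have cl: "closure A = interior A \<union> frontier A"
      using interior_subset closure_subset by (auto simp: frontier_def)
    define Z where "Z = {s \<in> {0..1}. \<exists>x\<in>closure A. slide r s x = p}"
    have Z_int: "\<exists>x\<in>interior A. slide r s x = p" if "s \<in> Z" for s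
      using that p(2) unfolding Z_def cl by blast
    have "closed Z"
    proof -
      define Q where "Q = {z \<in> {0..1} \<times> closure A. slide r (fst z) (snd z) = p}"
      have "continuous_on UNIV f"
        using lin by (simp add: linear_continuous_on linear_conv_bounded_linear)
      then have "continuous_on ({0..1} \<times> closure A) (\<lambda>z. f (snd z))"
        by (rule continuous_on_compose2) (auto intro: continuous_intros)
      then have "continuous_on ({0..1} \<times> closure A) (\<lambda>z. slide r (fst z) (snd z))"
        unfolding slide_def r by (intro continuous_intros)
      then have "closedin (top_of_set ({0..1} \<times> closure A)) Q"
        unfolding Q_def by (intro continuous_closedin_preimage_constant)
      moreover have "compact ({0..1::real} \<times> closure A)"
        using A by (intro compact_Times) (auto simp: compact_closure)
      ultimately have "compact Q" by (metis closedin_compact)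
      then have "compact (fst ` Q)" by (intro compact_continuous_image continuous_intros)
      moreover have "fst ` Q = Z" by (force simp: Q_def Z_def)
      ultimately show ?thesis by (simp add: compact_imp_closed)
    qed
    then have "closedin (top_of_set {0..1}) Z"
      by (intro closed_subset) (auto simp: Z_def)
    moreover have "openin (top_of_set {0..1}) Z"
      unfolding openin_euclidean_subtopology_iff
    proof (intro conjI ballI)
      show "Z \<subseteq> {0..1}" by (auto simp: Z_def)
      fix s assume s: "s \<in> Z"
      then obtain x where x: "x \<in> interior A" "slide r s x = p" using Z_int by blast
      have "inj (slide f s)"
      proof (cases "s = 1/2")
        case True
        have "p \<in> range (slide r (1/2))" using x(2) True by blast
        then have "inj (slide f (1/2))" using p(2) by (auto simp: N_def split: if_splits)
        then show ?thesis using True by (simp only:)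
      next
        case False
        with s show ?thesis by (intro inj_slide[OF f]) (auto simp: Z_def)
      qed
      from slide_solution_stable[OF f this open_interior x(1), of t]
      obtain e where e: "e > 0" "\<And>s'. \<bar>s - s'\<bar> < e \<Longrightarrow> p \<in> slide r s' ` interior A"
        using x(2) unfolding r by blast
      have "s' \<in> Z" if "s' \<in> {0..1}" "dist s' s < e" for s'
        using e(2)[of s'] that by (auto simp: Z_def cl dist_real_def abs_minus_commute)
      with e(1) show "\<exists>e>0. \<forall>x'\<in>{0..1}. dist x' s < e \<longrightarrow> x' \<in> Z" by blast
    qed
    ultimately have "Z = {} \<or> Z = {0..1}"
      using connected_Icc[of "0::real" 1] unfolding connected_clopen by blast
    then have "0 \<in> Z \<longleftrightarrow> 1 \<in> Z" by auto
    moreover have "0 \<in> Z \<longleftrightarrow> p \<in> A"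
      using Z_int[of 0] interior_subset[of A] closure_subset[of A] by (auto simp: Z_def)
    moreover have "1 \<in> Z \<longleftrightarrow> p \<in> r ` A"
    proof
      assume "1 \<in> Z"
      then obtain x where "x \<in> interior A" "slide r 1 x = p" using Z_int by blast
      then show "p \<in> r ` A" using interior_subset[of A] by auto
    next
      assume "p \<in> r ` A"
      then show "1 \<in> Z" using closure_subset[of A] by (auto simp: Z_def)
    qed
    ultimately show False using p(1) by blast
  qed
qed

section \<open>The volume swept by a small set\<close>

text \<open>
  The height along the direction \<open>e\<close> of motion of \<open>a\<close> determines the time up to an error of order \<open>\<delta> / h\<close>.
\<close>

lemma sweep_height:
  fixes f :: "'a::euclidean_space \<Rightarrow> 'a"
  assumes f: "orthogonal_transformation f" and r: "r = (\<lambda>x. f x + t)"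
    and e: "norm e = 1" and v: "r a - a = h *\<^sub>R e"
    and s: "s \<in> {0..1}" and dist: "dist b a \<le> \<delta>"
  shows "\<bar>slide r s b \<bullet> e - (a \<bullet> e + s * h)\<bar> \<le> \<delta>"
proof -
  have lin: "linear f" by (rule orthogonal_transformation_linear[OF f])
  have "slide r s b - slide r s a = slide f s (b - a)"
    by (simp add: slide_def r linear_diff[OF lin] algebra_simps)
  moreover have "slide r s a = a + (s * h) *\<^sub>R e"
    using v by (simp add: slide_def)
  ultimately have eq: "slide r s b = a + (s * h) *\<^sub>R e + slide f s (b - a)"
    by (simp add: algebra_simps)
  have ee: "e \<bullet> e = 1" using e by (simp add: norm_eq_1)
  have "slide r s b \<bullet> e - (a \<bullet> e + s * h) = slide f s (b - a) \<bullet> e"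
    unfolding eq by (simp add: inner_add_left ee)
  also have "\<bar>\<dots>\<bar> \<le> norm (slide f s (b - a)) * norm e"
    by (rule Cauchy_Schwarz_ineq2)
  also have "\<dots> \<le> norm (b - a)"
    using norm_slide_le[OF f s, of "b - a"] e by simp
  finally show ?thesis using dist by (simp add: dist_norm)
qed

text \<open>
  The second estimate needs no projection to the hyperplane: the difference of the two points is
  \<open>u = (s - s') h e + q\<close>, and since \<open>u\<close> is orthogonal to \<open>e\<close>, \<open>|u|^2 = u \<bullet> q \<le> |u| |q|\<close>.
\<close>

lemma sweep_slice:
  fixes f :: "'a::euclidean_space \<Rightarrow> 'a"
  assumes f: "orthogonal_transformation f" and r: "r = (\<lambda>x. f x + t)"
    and e: "norm e = 1" and v: "r a - a = h *\<^sub>R e" "0 \<le> h"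
    and s: "s \<in> {0..1}" "s' \<in> {0..1}"
    and dist: "dist b a \<le> \<delta>" "dist b' a \<le> \<delta>" "dist b b' \<le> \<delta>"
    and same: "slide r s b \<bullet> e = slide r s' b' \<bullet> e"
  shows "\<bar>s - s'\<bar> * h \<le> 2 * \<delta>"
    and "dist (slide r s b) (slide r s' b') \<le> \<delta> * (1 + 2 * \<bar>s - s'\<bar>)"
proof -
  have lin: "linear f" by (rule orthogonal_transformation_linear[OF f])
  have "\<bar>s * h - s' * h\<bar> \<le> 2 * \<delta>"
    using sweep_height[OF f r e v(1) s(1) dist(1)] sweep_height[OF f r e v(1) s(2) dist(2)] same by linarith
  then show "\<bar>s - s'\<bar> * h \<le> 2 * \<delta>"
    using v(2) by (simp add: abs_mult flip: left_diff_distrib)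
  define u where "u = slide r s b - slide r s' b'"
  define y where "y = b' - a"
  define q where "q = slide f s (b - b') + (s - s') *\<^sub>R (f y - y)"
  have "slide r s b - slide r s b' = slide f s (b - b')"
    by (simp add: slide_def r linear_diff[OF lin] algebra_simps)
  moreover have "slide r s b' - slide r s' b' = (s - s') *\<^sub>R (r b' - b')"
    by (simp add: slide_def algebra_simps)
  moreover have "r b' - b' = h *\<^sub>R e + (f y - y)"
    unfolding v(1)[symmetric] by (simp add: y_def r linear_diff[OF lin])
  ultimately have u: "u = ((s - s') * h) *\<^sub>R e + q"
    by (simp add: u_def q_def algebra_simps)
  have ue: "u \<bullet> e = 0" using same by (simp add: u_def inner_diff_left)
  have "norm u * norm u = u \<bullet> u" by (simp add: norm_eq_sqrt_inner)
  also have "u \<bullet> u = u \<bullet> (((s - s') * h) *\<^sub>R e + q)" using u by simp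
  also have "\<dots> = u \<bullet> q" by (simp add: inner_add_right ue)
  also have "\<dots> \<le> norm u * norm q" by (rule norm_cauchy_schwarz)
  finally have "norm u \<le> norm q" by (cases "u = 0") auto
  also have "norm q \<le> norm (slide f s (b - b')) + norm ((s - s') *\<^sub>R (f y - y))"
    unfolding q_def by (rule norm_triangle_ineq)
  also have "norm (slide f s (b - b')) \<le> \<delta>"
    using norm_slide_le[OF f s(1), of "b - b'"] dist(3) by (simp add: dist_norm)
  also have "norm ((s - s') *\<^sub>R (f y - y)) \<le> \<bar>s - s'\<bar> * (2 * \<delta>)"
  proof -
    have "norm (f y - y) \<le> 2 * \<delta>"
      using norm_triangle_ineq4[of "f y" y] f dist(2) by (simp add: orthogonal_transformation_norm y_def dist_norm)
    then show ?thesis by (simp add: mult_left_mono)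
  qed
  finally show "dist (slide r s b) (slide r s' b') \<le> \<delta> * (1 + 2 * \<bar>s - s'\<bar>)"
    by (simp add: u_def dist_norm algebra_simps)
qed

text \<open>
  The analytic core of the passage to small diameters. Here \<open>\<kappa>\<close> bounds the time difference of
  two points in the same slice. If the displacement \<open>h\<close> exceeds \<open>\<eta>\<close>, then \<open>\<kappa> = 2 \<delta> / \<eta>\<close> is small. Otherwise
  only the trivial bound \<open>\<kappa> = 1\<close> is available; the resulting factor \<open>3 ^ k\<close>
  is compensated by the smallness of \<open>\<eta>\<close>.
\<close>

lemma sweep_volume_limit:
  fixes W \<epsilon> :: real
  assumes "0 < \<epsilon>" "0 \<le> W"
  shows "\<exists>\<delta>\<^sub>0>0. \<forall>h\<in>{0..W}. \<forall>\<delta>\<in>{0..\<delta>\<^sub>0}. \<exists>\<kappa>\<ge>0.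
     (\<forall>\<sigma>\<in>{0..1}. \<sigma> * h \<le> 2 * \<delta> \<longrightarrow> \<sigma> \<le> \<kappa>) \<and> (h + 2 * \<delta>) * (1 + 2 * \<kappa>) ^ k \<le> W + \<epsilon>"
proof -
  \<comment> \<open>So small that \<open>(\<eta> + \<eta>) 3 ^ k = \<epsilon>\<close>.\<close>
  define \<eta> where "\<eta> = \<epsilon> / (2 * 3 ^ k)"
  have \<eta>: "\<eta> > 0" "\<eta> * 3 ^ k = \<epsilon> / 2" using assms by (auto simp: \<eta>_def)
  have "((\<lambda>x. (W + 2 * x) * (1 + 2 * (2 * x / \<eta>)) ^ k) \<longlongrightarrow> (W + 2 * 0) * (1 + 2 * (2 * 0 / \<eta>)) ^ k) (at_right 0)"
    using \<eta>(1) by (intro tendsto_intros) auto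
  then have "\<forall>\<^sub>F x in at_right 0. (W + 2 * x) * (1 + 2 * (2 * x / \<eta>)) ^ k < W + \<epsilon>"
    by (rule order_tendstoD) (use assms in auto)
  then obtain b where b: "b > 0" "\<And>x. 0 < x \<Longrightarrow> x < b \<Longrightarrow> (W + 2 * x) * (1 + 2 * (2 * x / \<eta>)) ^ k < W + \<epsilon>"
    unfolding eventually_at_right_field by auto
  define \<delta>\<^sub>0 where "\<delta>\<^sub>0 = min (b / 2) (\<eta> / 2)"
  have \<delta>\<^sub>0: "\<delta>\<^sub>0 > 0" "2 * \<delta>\<^sub>0 \<le> \<eta>" "(W + 2 * \<delta>\<^sub>0) * (1 + 2 * (2 * \<delta>\<^sub>0 / \<eta>)) ^ k \<le> W + \<epsilon>"
  proof -
    show pos: "\<delta>\<^sub>0 > 0" and "2 * \<delta>\<^sub>0 \<le> \<eta>" using b(1) \<eta>(1) by (auto simp: \<delta>\<^sub>0_def)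
    have "\<delta>\<^sub>0 < b" using b(1) by (auto simp: \<delta>\<^sub>0_def)
    from b(2)[OF pos this] show "(W + 2 * \<delta>\<^sub>0) * (1 + 2 * (2 * \<delta>\<^sub>0 / \<eta>)) ^ k \<le> W + \<epsilon>" by simp
  qed
  have "\<exists>\<kappa>\<ge>0. (\<forall>\<sigma>\<in>{0..1}. \<sigma> * h \<le> 2 * \<delta> \<longrightarrow> \<sigma> \<le> \<kappa>) \<and> (h + 2 * \<delta>) * (1 + 2 * \<kappa>) ^ k \<le> W + \<epsilon>"
    if h: "h \<in> {0..W}" and \<delta>: "\<delta> \<in> {0..\<delta>\<^sub>0}" for h \<delta>
  proof (cases "h \<le> \<eta>")
    case True
    have "(h + 2 * \<delta>) * (1 + 2 * 1) ^ k \<le> (\<eta> + \<eta>) * 3 ^ k"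
      using True \<delta> \<delta>\<^sub>0 h by (intro mult_mono) auto
    also have "\<dots> = \<epsilon>" using \<eta>(2) by (simp add: algebra_simps)
    finally show ?thesis using assms by (intro exI[of _ 1]) auto
  next
    case False
    have "(h + 2 * \<delta>) * (1 + 2 * (2 * \<delta> / \<eta>)) ^ k \<le> (W + 2 * \<delta>\<^sub>0) * (1 + 2 * (2 * \<delta>\<^sub>0 / \<eta>)) ^ k"
      using False \<delta> \<delta>\<^sub>0 h \<eta>(1)
      by (intro mult_mono power_mono add_mono divide_right_mono) auto
    moreover have "\<sigma> \<le> 2 * \<delta> / \<eta>" if "\<sigma> \<in> {0..1}" "\<sigma> * h \<le> 2 * \<delta>" for \<sigma>
    proof -
      have "\<sigma> * \<eta> \<le> \<sigma> * h" using False that by (intro mult_left_mono) auto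
      with that show ?thesis using \<eta>(1) by (simp add: pos_le_divide_eq)
    qed
    ultimately show ?thesis using \<delta>\<^sub>0(3) \<delta> \<eta>(1) by (intro exI[of _ "2 * \<delta> / \<eta>"]) auto
  qed
  with \<delta>\<^sub>0(1) show ?thesis by blast
qed

lemma emeasure_sweep_le:
  fixes f :: "real ^ 'n \<Rightarrow> real ^ 'n"
  assumes f: "orthogonal_transformation f" and r: "r = (\<lambda>x. f x + t)"
    and "0 < \<epsilon>" "0 \<le> W"
  obtains \<delta>\<^sub>0 where "0 < \<delta>\<^sub>0"
    "\<And>B. compact B \<Longrightarrow> B \<noteq> {} \<Longrightarrow> diameter B \<le> \<delta>\<^sub>0 \<Longrightarrow> (\<And>b. b \<in> B \<Longrightarrow> norm (r b - b) \<le> W) \<Longrightarrow>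
       compact (\<Union>s\<in>{0..1}. slide r s ` B) \<and>
       emeasure lborel (\<Union>s\<in>{0..1}. slide r s ` B) \<le>
         ennreal (W + \<epsilon>) * (ennreal (unit_ball_vol (real (CARD('n) - 1)) / 2 ^ (CARD('n) - 1)) * ennreal (diameter B ^ (CARD('n) - 1)))"
proof -
  let ?k = "CARD('n) - 1"
  obtain \<delta>\<^sub>0 where \<delta>\<^sub>0: "\<delta>\<^sub>0 > 0" "\<And>h \<delta>. h \<in> {0..W} \<Longrightarrow> \<delta> \<in> {0..\<delta>\<^sub>0} \<Longrightarrow> \<exists>\<kappa>\<ge>0.
     (\<forall>\<sigma>\<in>{0..1}. \<sigma> * h \<le> 2 * \<delta> \<longrightarrow> \<sigma> \<le> \<kappa>) \<and> (h + 2 * \<delta>) * (1 + 2 * \<kappa>) ^ ?k \<le> W + \<epsilon>"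
    using sweep_volume_limit[OF assms(3,4), of ?k] by blast
  show ?thesis
  proof (rule that[OF \<delta>\<^sub>0(1)], rule conjI)
    fix B assume B: "compact B" "B \<noteq> {}" "diameter B \<le> \<delta>\<^sub>0" "\<And>b. b \<in> B \<Longrightarrow> norm (r b - b) \<le> W"
    let ?S = "\<Union>s\<in>{0..1}. slide r s ` B"
    show compact: "compact ?S"
    proof -
      have "continuous_on UNIV f"
        using orthogonal_transformation_linear[OF f]
        by (simp add: linear_continuous_on linear_conv_bounded_linear)
      then have "continuous_on ({0..1} \<times> B) (\<lambda>z. f (snd z))"
        by (rule continuous_on_compose2) (auto intro: continuous_intros)
      then have "continuous_on ({0..1} \<times> B) (\<lambda>z. slide r (fst z) (snd z))"
        unfolding slide_def r by (intro continuous_intros)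
      then have "compact ((\<lambda>z. slide r (fst z) (snd z)) ` ({0..1} \<times> B))"
        using B(1) by (intro compact_continuous_image compact_Times) auto
      moreover have "(\<lambda>z. slide r (fst z) (snd z)) ` ({0..1} \<times> B) = ?S" by force
      ultimately show ?thesis by simp
    qed
    obtain a where a: "a \<in> B" using B(2) by blast
    define \<delta> where "\<delta> = diameter B"
    have \<delta>: "\<delta> \<in> {0..\<delta>\<^sub>0}" using B by (auto simp: \<delta>_def diameter_ge_0 compact_imp_bounded)
    have dist: "dist x y \<le> \<delta>" if "x \<in> B" "y \<in> B" for x y
      unfolding \<delta>_def using that B(1) by (intro diameter_bounded_bound compact_imp_bounded)
    define h where "h = norm (r a - a)"
    have h: "h \<in> {0..W}" using B(4)[OF a] by (simp add: h_def)
    \<comment> \<open>If \<open>a\<close> does not move, any direction will do.\<close>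
    obtain e where e: "norm e = 1" "r a - a = h *\<^sub>R e"
    proof (cases "h = 0")
      case True
      then show ?thesis using that[of "axis undefined 1"] by (simp add: h_def)
    next
      case False
      then show ?thesis using that[of "(r a - a) /\<^sub>R h"] by (simp add: h_def)
    qed
    from \<delta>\<^sub>0(2)[OF h \<delta>] obtain \<kappa> where \<kappa>: "\<kappa> \<ge> 0" "\<And>\<sigma>. \<sigma> \<in> {0..1} \<Longrightarrow> \<sigma> * h \<le> 2 * \<delta> \<Longrightarrow> \<sigma> \<le> \<kappa>"
      "(h + 2 * \<delta>) * (1 + 2 * \<kappa>) ^ ?k \<le> W + \<epsilon>" by blast
    let ?c = "unit_ball_vol (real ?k)"
    have "emeasure lborel ?S \<le> ennreal ((a \<bullet> e + h + \<delta>) - (a \<bullet> e - \<delta>)) *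
        ennreal (?c * (\<delta> * (1 + 2 * \<kappa>) / 2) ^ ?k)"
    proof (rule emeasure_le_of_slices[OF compact e(1)])
      show "0 \<le> \<delta> * (1 + 2 * \<kappa>)" using \<delta> \<kappa>(1) by auto
      fix x assume "x \<in> ?S"
      then obtain s b where sb: "s \<in> {0..1}" "b \<in> B" "x = slide r s b" by blast
      have "\<bar>x \<bullet> e - (a \<bullet> e + s * h)\<bar> \<le> \<delta>"
        unfolding sb(3) by (rule sweep_height[OF f r e sb(1) dist[OF sb(2) a]])
      moreover have "s * h \<le> 1 * h" "0 \<le> s * h" using h sb(1) by (auto intro: mult_right_mono mult_left_le_one_le)
      ultimately show "x \<bullet> e \<in> {a \<bullet> e - \<delta>..a \<bullet> e + h + \<delta>}" by (auto simp: abs_le_iff)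
    next
      fix x y assume xy: "x \<in> ?S" "y \<in> ?S" "x \<bullet> e = y \<bullet> e"
      then obtain s b s' b' where sb: "s \<in> {0..1}" "b \<in> B" "x = slide r s b"
         "s' \<in> {0..1}" "b' \<in> B" "y = slide r s' b'" by blast
      note sl = sweep_slice[OF f r e _ sb(1,4) dist[OF sb(2) a] dist[OF sb(5) a] dist[OF sb(2,5)]
          xy(3)[unfolded sb(3,6)]]
      have "\<bar>s - s'\<bar> \<le> \<kappa>" using sl(1) h sb(1,4) by (intro \<kappa>(2)) auto
      then have "\<delta> * (1 + 2 * \<bar>s - s'\<bar>) \<le> \<delta> * (1 + 2 * \<kappa>)" using \<delta> by (intro mult_left_mono) auto
      with sl(2) h show "dist x y \<le> \<delta> * (1 + 2 * \<kappa>)" unfolding sb(3,6) by auto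
    qed
    also have "\<dots> = ennreal (((h + 2 * \<delta>) * (1 + 2 * \<kappa>) ^ ?k) * (?c / 2 ^ ?k * \<delta> ^ ?k))"
      using h \<delta> \<kappa>(1) by (subst ennreal_mult[symmetric]) (auto simp: power_mult_distrib power_divide mult_ac)
    also have "\<dots> \<le> ennreal ((W + \<epsilon>) * (?c / 2 ^ ?k * \<delta> ^ ?k))"
      using \<kappa>(3) \<delta> by (intro ennreal_leI mult_right_mono) auto
    also have "\<dots> = ennreal (W + \<epsilon>) * (ennreal (?c / 2 ^ ?k) * ennreal (\<delta> ^ ?k))"
    proof -
      have "0 \<le> W + \<epsilon>" "0 \<le> ?c / 2 ^ ?k" "0 \<le> \<delta> ^ ?k" using assms(3,4) \<delta> by auto
      then show ?thesis by (simp only: ennreal_mult mult_nonneg_nonneg)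
    qed
    finally show "emeasure lborel ?S \<le> ennreal (W + \<epsilon>) * (ennreal (?c / 2 ^ ?k) * ennreal (diameter B ^ ?k))"
      by (simp add: \<delta>_def)
  qed
qed

section \<open>Covering the boundary by small sets\<close>

lemma hausdorff_measure_mono: "S \<subseteq> T \<Longrightarrow> hausdorff_measure k S \<le> hausdorff_measure k T"
  unfolding hausdorff_measure_eq_SUP hausdorff_content_def
  by (intro SUP_mono' mult_left_mono INF_superset_mono) auto

lemma ennreal_mult_INF_greatest:
  fixes K :: ennreal
  assumes "K \<noteq> 0" "K \<noteq> top" "\<And>B. B \<in> I \<Longrightarrow> x \<le> K * f B"
  shows "x \<le> K * (INF B\<in>I. f B)"
proof -
  have "x / K \<le> (INF B\<in>I. f B)"
    using assms by (intro INF_greatest divide_le_posI_ennreal) (auto simp: mult.commute zero_less_iff_neq_zero)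
  then have "K * (x / K) \<le> K * (INF B\<in>I. f B)" by (rule mult_left_mono) simp
  also have "K * (x / K) = x"
    using assms(1,2) by (simp add: ennreal_times_divide mult.commute[of K] mult_divide_eq_ennreal)
  finally show ?thesis .
qed

text \<open>
  The members of a cover of the boundary are replaced by their closures cut with the boundary: their
  diameters do not grow, their sweeps become compact, hence measurable, and the bound \<open>W\<close>
  on the displacement applies to all their points.
\<close>

lemma hausdorff_measure_sym_diff_le:
  fixes f :: "real ^ 'n \<Rightarrow> real ^ 'n"
  assumes A: "bounded A" and f: "orthogonal_transformation f" and r: "r = (\<lambda>x. f x + t)"
    and W: "0 \<le> W" "\<And>a. a \<in> frontier A \<Longrightarrow> norm (r a - a) \<le> W" and \<epsilon>: "0 < \<epsilon>"
  shows "hausdorff_measure CARD('n) (sym_diff A (r ` A)) \<le> ennreal (W + \<epsilon>) * hausdorff_measure (CARD('n) - 1) (frontier A)"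
proof -
  let ?k = "CARD('n) - 1"
  let ?c = "ennreal (unit_ball_vol (real ?k) / 2 ^ ?k)"
  obtain N where N: "negligible N" "sym_diff A (r ` A) \<subseteq> (\<Union>s\<in>{0..1}. slide r s ` frontier A) \<union> N"
    by (rule sym_diff_subset_sweep[OF A f r])
  then have N_sets: "N \<in> sets lebesgue" by (intro negligible_imp_sets)
  obtain \<delta>\<^sub>0 where \<delta>\<^sub>0: "0 < \<delta>\<^sub>0"
    and sweep: "\<And>B. compact B \<Longrightarrow> B \<noteq> {} \<Longrightarrow> diameter B \<le> \<delta>\<^sub>0 \<Longrightarrow> (\<And>b. b \<in> B \<Longrightarrow> norm (r b - b) \<le> W) \<Longrightarrow>
       compact (\<Union>s\<in>{0..1}. slide r s ` B) \<and>
       emeasure lborel (\<Union>s\<in>{0..1}. slide r s ` B) \<le> ennreal (W + \<epsilon>) * (?c * ennreal (diameter B ^ ?k))"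
    by (rule emeasure_sweep_le[OF f r \<epsilon> W(1)]) blast
  have cover: "hausdorff_measure CARD('n) (sym_diff A (r ` A)) \<le>
      ennreal (W + \<epsilon>) * ?c * (\<Sum>j. if B j = {} then 0 else ennreal (diameter (B j) ^ ?k))"
    if B: "\<And>j. bounded (B j) \<and> diameter (B j) \<le> \<delta>\<^sub>0" "frontier A \<subseteq> (\<Union>j. B j)" for B :: "nat \<Rightarrow> (real ^ 'n) set"
  proof -
    define C where "C j = closure (B j) \<inter> frontier A" for j
    let ?S = "\<lambda>j. \<Union>s\<in>{0..1}. slide r s ` C j"
    have diam: "diameter (C j) \<le> diameter (B j)" for j
      using diameter_subset[of "C j" "closure (B j)"] B(1)[of j]
      by (simp add: C_def diameter_closure bounded_closure)
    have S: "compact (?S j) \<and> emeasure lborel (?S j) \<le>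
        ennreal (W + \<epsilon>) * ?c * (if B j = {} then 0 else ennreal (diameter (B j) ^ ?k))" for j
    proof (cases "C j = {}")
      case False
      have "compact (C j)"
        using B(1)[of j] by (simp add: C_def compact_Int_closed compact_closure)
      moreover have "diameter (C j) \<le> \<delta>\<^sub>0" using diam[of j] B(1)[of j] by simp
      moreover have "norm (r b - b) \<le> W" if "b \<in> C j" for b using that W(2) by (simp add: C_def)
      ultimately have *: "compact (?S j)"
        "emeasure lborel (?S j) \<le> ennreal (W + \<epsilon>) * (?c * ennreal (diameter (C j) ^ ?k))"
        using sweep[OF _ False] by blast+
      have "ennreal (diameter (C j) ^ ?k) \<le> ennreal (diameter (B j) ^ ?k)"
        using diam[of j] B(1)[of j] by (intro ennreal_leI power_mono diameter_ge_0) (auto simp: C_def bounded_Int bounded_closure)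
      then have "ennreal (W + \<epsilon>) * (?c * ennreal (diameter (C j) ^ ?k)) \<le> ennreal (W + \<epsilon>) * (?c * ennreal (diameter (B j) ^ ?k))"
        by (intro mult_left_mono) auto
      moreover have "B j \<noteq> {}" using False by (auto simp: C_def)
      ultimately show ?thesis using * by (auto simp: mult.assoc intro: order_trans)
    qed simp
    have S_sets: "?S j \<in> sets lborel" for j
      unfolding sets_lborel by (rule borel_compact[OF conjunct1[OF S]])
    then have UN_sets: "(\<Union>j. ?S j) \<in> sets lborel" by (intro sets.countable_UN) auto
    have "(\<Union>s\<in>{0..1}. slide r s ` frontier A) \<subseteq> (\<Union>j. ?S j)"
    proof (intro UN_least image_subsetI)
      fix s :: real and a assume s: "s \<in> {0..1}" and a: "a \<in> frontier A"
      with B(2) obtain j where "a \<in> B j" by blast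
      then have "a \<in> C j" using a closure_subset by (auto simp: C_def)
      with s have "slide r s a \<in> ?S j" by blast
      then show "slide r s a \<in> (\<Union>j. ?S j)" by (rule UN_I[OF UNIV_I])
    qed
    then have sub: "sym_diff A (r ` A) \<subseteq> (\<Union>j. ?S j) \<union> N"
      by (rule subset_trans[OF N(2) Un_mono[OF _ order_refl]])
    have "hausdorff_measure CARD('n) (sym_diff A (r ` A)) \<le> hausdorff_measure CARD('n) ((\<Union>j. ?S j) \<union> N)"
      using sub by (rule hausdorff_measure_mono)
    also have "\<dots> \<le> emeasure lebesgue ((\<Union>j. ?S j) \<union> N)"
    proof -
      have "(\<Union>j. ?S j) \<union> N \<in> sets lebesgue" using UN_sets N_sets by (intro sets.Un) auto
      moreover have "DIM(real ^ 'n) = CARD('n)" by simp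
      ultimately show ?thesis using hausdorff_measure_le_lebesgue by metis
    qed
    also have "\<dots> \<le> emeasure lebesgue (\<Union>j. ?S j) + emeasure lebesgue N"
      using UN_sets N_sets by (intro emeasure_subadditive) auto
    also have "emeasure lebesgue N = 0"
      using negligible_iff_emeasure0[OF N_sets] N(1) by blast
    also have "emeasure lebesgue (\<Union>j. ?S j) = emeasure lborel (\<Union>j. ?S j)"
      using UN_sets by simp
    also have "\<dots> \<le> (\<Sum>j. emeasure lborel (?S j))"
      using S_sets by (intro emeasure_subadditive_countably) auto
    also have "\<dots> \<le> (\<Sum>j. ennreal (W + \<epsilon>) * ?c * (if B j = {} then 0 else ennreal (diameter (B j) ^ ?k)))"
      using S by (intro suminf_le) auto
    also have "\<dots> = ennreal (W + \<epsilon>) * ?c * (\<Sum>j. if B j = {} then 0 else ennreal (diameter (B j) ^ ?k))"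
      by (rule ennreal_suminf_cmult)
    finally show ?thesis by simp
  qed
  have "hausdorff_measure CARD('n) (sym_diff A (r ` A)) \<le> ennreal (W + \<epsilon>) * ?c *
     (INF B \<in> {B. (\<forall>j. bounded (B j) \<and> diameter (B j) \<le> \<delta>\<^sub>0) \<and> frontier A \<subseteq> (\<Union>j. B j)}.
        \<Sum>j. if B j = {} then 0 else ennreal (diameter (B j) ^ ?k))"
  proof (rule ennreal_mult_INF_greatest)
    have "0 < unit_ball_vol (real ?k) / 2 ^ ?k" by simp
    then show "ennreal (W + \<epsilon>) * ?c \<noteq> 0" using W(1) \<epsilon> by (simp add: ennreal_eq_0_iff not_le del: ennreal_plus)
    show "ennreal (W + \<epsilon>) * ?c \<noteq> top" by (simp add: ennreal_mult_eq_top_iff)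
  qed (use cover in auto)
  also have "\<dots> = ennreal (W + \<epsilon>) * hausdorff_content ?k \<delta>\<^sub>0 (frontier A)"
    by (simp only: hausdorff_content_def mult.assoc)
  also have "\<dots> \<le> ennreal (W + \<epsilon>) * hausdorff_measure ?k (frontier A)"
    unfolding hausdorff_measure_eq_SUP using \<delta>\<^sub>0 by (intro mult_left_mono SUP_upper) auto
  finally show ?thesis .
qed

text \<open>
  Finiteness of \<open>h\<close> is essential: the right-hand side is \<open>0\<close> for \<open>W = 0\<close> and \<open>h = \<infinity>\<close>.
\<close>

lemma ennreal_mult_le_of_add_epsilon:
  assumes "0 \<le> W" "h < top" "\<And>\<epsilon>. 0 < \<epsilon> \<Longrightarrow> x \<le> ennreal (W + \<epsilon>) * h"
  shows "x \<le> ennreal W * h"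
proof -
  obtain m where m: "h = ennreal m" "0 \<le> m" using assms(2) by (cases h) auto
  show ?thesis
  proof (rule ennreal_le_epsilon)
    fix e :: real assume "0 < e"
    have "x \<le> ennreal (W + e / (m + 1)) * h" using \<open>0 < e\<close> m(2) by (intro assms(3)) simp
    also have "\<dots> = ennreal ((W + e / (m + 1)) * m)"
      unfolding m(1) using m(2) assms(1) \<open>0 < e\<close> by (intro ennreal_mult[symmetric]) auto
    also have "(W + e / (m + 1)) * m = W * m + e * (m / (m + 1))"
      by (simp add: algebra_simps)
    also have "ennreal \<dots> \<le> ennreal (W * m + e)"
      using m(2) \<open>0 < e\<close> by (intro ennreal_leI add_left_mono mult_right_le_one_le) auto
    also have "\<dots> = ennreal W * h + ennreal e"
      using m assms(1) \<open>0 < e\<close> by (simp add: ennreal_mult)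
    finally show "x \<le> ennreal W * h + ennreal e" .
  qed
qed

lemma hausdorff_measure_empty: "hausdorff_measure k {} = 0"
proof -
  have "hausdorff_content k \<delta> {} = 0" if "0 < \<delta>" for \<delta>
    using hausdorff_content_le_cover[of "\<lambda>_. {}" \<delta> "{}" k] that by simp
  then have "hausdorff_measure k {} \<le> 0"
    unfolding hausdorff_measure_eq_SUP by (intro SUP_least) simp
  then show ?thesis by simp
qed

theorem corollary3:
  fixes A :: "(real ^ 'n) set"
    and M :: "real ^ 'n ^ 'n" and t :: "real ^ 'n"
    and r :: "real ^ 'n \<Rightarrow> real ^ 'n" and w :: real
  assumes "bounded A"
    and "rotation_matrix M"
    and "r = (\<lambda>x. M *v x + t)"
    and "w = (SUP a\<in>frontier A. norm (a - M *v a))"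
    and "measure_rectifiable (hausdorff_measure (CARD('n) - 1)) (CARD('n) - 1) (frontier A)"
  shows "hausdorff_measure CARD('n) (sym_diff A (r ` A))
           \<le> ennreal (norm t + w) * hausdorff_measure (CARD('n) - 1) (frontier A)"
proof (cases "A = {}")
  case True
  then show ?thesis by (simp add: hausdorff_measure_empty)
next
  case False
  obtain b where b: "w = norm (b - M *v b)" "\<And>a. a \<in> frontier A \<Longrightarrow> norm (a - M *v a) \<le> w"
    using frontier_displacement_SUP_attained[OF assms(1) False, of M] assms(4) by metis
  have f: "orthogonal_transformation ((*v) M)"
    using assms(2) by (simp add: rotation_matrix_def orthogonal_transformation_matrix)
  have W: "norm (r a - a) \<le> norm t + w" if "a \<in> frontier A" for a
  proof -
    have "norm (r a - a) \<le> norm t + norm (M *v a - a)"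
      unfolding assms(3) using norm_triangle_ineq[of t "M *v a - a"] by (simp add: algebra_simps)
    with b(2)[OF that] show ?thesis by (simp add: norm_minus_commute)
  qed
  have "0 \<le> norm t + w" using b(1) by simp
  moreover have "hausdorff_measure (CARD('n) - 1) (frontier A) < top"
    using assms(5) by (simp add: measure_rectifiable_def)
  ultimately show ?thesis
    by (rule ennreal_mult_le_of_add_epsilon)
      (rule hausdorff_measure_sym_diff_le[OF assms(1) f assms(3) \<open>0 \<le> norm t + w\<close> W])
qed

end
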